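(* Let $f\colon M\to\mathbb{R}^4$ be a centro-affine nondegenerate hypersurface with a $\widetilde{J}$-tangent centro-affine vector field $C=-f$, and suppose that both $\mathcal{D}^-$ and $\mathcal{D}^+$ are null-directions for $f$. Then $f$ is both an affine hypersphere and a hyperquadric. Moreover, if $f\colon M\to\mathbb{R}^4$ is a centro-affine nondegenerate hyperquadric with a $\widetilde{J}$-tangent centro-affine vector field $C=-f$, then $\mathcal{D}^-$ and $\mathcal{D}^+$ are null-directions for $f$.
   Context: All objects are smooth. $M$ is a connected, orientable $3$-dimensional manifold and $f\colon M\to\mathbb{R}^4$ is an immersion (hypersurface); $D$ is the standard flat connection on $\mathbb{R}^4$. For a transversal vector field $C$ along $f$, the formulas $D_Xf_*Y=f_*(\nabla_XY)+h(X,Y)C$ and $D_XC=-f_*(SX)+\tau(X)C$ define the torsion-free connection $\nabla$, the second fundamental form $h$, the shape operator $S$ and the transversal connection form $\tau$. $f$ is nondegenerate if $h$ is nondegenerate (this does not depend on $C$). $f$ is a centro-affine hypersurface if the position vector $f(x)$ is transversal to $f_*(T_xM)$ for every $x\in M$; the centro-affine vector field is $C=-f$, for which $S=\mathrm{I}$ and $\tau=0$. The induced volume element of $C$ is $\Theta(X_1,X_2,X_3)=\det[f_*X_1,f_*X_2,f_*X_3,C]$; the metric volume form is $\omega_h(X_1,X_2,X_3)=|\det[h(X_i,X_j)]|^{1/2}$ for bases positively oriented relative to $\Theta$. For nondegenerate $f$ the Blaschke field is the transversal field, unique up to sign, with $\tau=0$ and $\omega_h=\Theta$. $f$ is an affine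 hypersphere if the shape operator of its Blaschke field is $S=\lambda\,\mathrm{I}$ with $\lambda$ constant. $f$ is a hyperquadric if its image lies in a nondegenerate quadric of $\mathbb{R}^4$ (the zero set of a polynomial of degree $2$). The para-complex structure on $\mathbb{R}^4$ is $\widetilde{J}(x_1,x_2,y_1,y_2)=(y_1,y_2,x_1,x_2)$. A transversal field $C$ is $\widetilde{J}$-tangent if $\widetilde{J}C_x\in f_*(T_xM)$ for every $x\in M$. The distribution $\mathcal{D}$ is the biggest $\widetilde{J}$-invariant distribution on $M$: $\mathcal{D}_x=f_*^{-1}\big(f_*(T_xM)\cap\widetilde{J}(f_*(T_xM))\big)$; when a $\widetilde{J}$-tangent transversal field exists it has rank $2$. $\mathcal{D}^{\pm}=\{v\in\mathcal{D}: \widetilde{J}f_*v=\pm f_*v\}$; these are $1$-dimensional distributions with $\mathcal{D}=\mathcal{D}^+\oplus\mathcal{D}^-$. A $1$-dimensional smooth distribution $\mathcal{A}\subset TM$ is a null-direction for $f$ if $h_x(v,v)=0$ for every $x\in M$ and $v\in\mathcal{A}_x$. *)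

theory Defs
  imports "HOL-Analysis.Analysis"
begin

section \<open>Smooth 3-manifolds\<close>

text \<open>\<open>C\<^sup>k\<close> on an \<^emph>\<open>open\<close> subset of a finite-dimensional space, by iterated directional
  derivatives.\<close>

primrec Ck_on :: "nat \<Rightarrow> 'a::real_normed_vector set \<Rightarrow> ('a \<Rightarrow> 'b::real_normed_vector) \<Rightarrow> bool" where
  "Ck_on 0 S g \<longleftrightarrow> continuous_on S g"
| "Ck_on (Suc k) S g \<longleftrightarrow> (\<forall>x\<in>S. g differentiable (at x)) \<and>
     (\<forall>v. Ck_on k S (\<lambda>x. frechet_derivative g (at x) v))"

definition smooth_on :: "'a::real_normed_vector set \<Rightarrow> ('a \<Rightarrow> 'b::real_normed_vector) \<Rightarrow> bool" where
  "smooth_on S g \<longleftrightarrow> (\<forall>k. Ck_on k S g)"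

text \<open>The underlying space of a manifold is a whole type. A chart is its domain together with the
  coordinate map, whose values outside the domain are irrelevant.\<close>

type_synonym 'm chart = "'m set \<times> ('m \<Rightarrow> real^3)"

definition is_chart :: "('m::topological_space) chart \<Rightarrow> bool" where
  "is_chart c \<longleftrightarrow> open (fst c) \<and> open (snd c ` fst c) \<and>
     (\<exists>g. homeomorphism (fst c) (snd c ` fst c) (snd c) g)"

abbreviation chart_inv :: "'m chart \<Rightarrow> real^3 \<Rightarrow> 'm" where
  "chart_inv c \<equiv> inv_into (fst c) (snd c)"

definition smooth_atlas :: "('m::topological_space) chart set \<Rightarrow> bool" where
  "smooth_atlas \<A> \<longleftrightarrow> (\<forall>c\<in>\<A>. is_chart c) \<and> (\<Union>c\<in>\<A>. fst c) = UNIV \<and>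
     (\<forall>c\<in>\<A>. \<forall>c'\<in>\<A>. smooth_on (snd c ` (fst c \<inter> fst c')) (snd c' \<circ> chart_inv c))"

text \<open>Orientability: the smooth structure given by \<open>\<A>\<close> contains an atlas whose transition maps
  all have positive Jacobian determinant.\<close>

definition orientable :: "('m::topological_space) chart set \<Rightarrow> bool" where
  "orientable \<A> \<longleftrightarrow> (\<exists>\<B>. smooth_atlas \<B> \<and> smooth_atlas (\<A> \<union> \<B>) \<and>
     (\<forall>c\<in>\<B>. \<forall>c'\<in>\<B>. \<forall>x\<in>fst c \<inter> fst c'.
        det (matrix (frechet_derivative (snd c' \<circ> chart_inv c) (at (snd c x)))) > 0))"

definition charts_at :: "'m chart set \<Rightarrow> 'm \<Rightarrow> 'm chart set" where
  "charts_at \<A> x = {c\<in>\<A>. x \<in> fst c}"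

text \<open>A tangent vector at \<open>x\<close> is the family of its coordinate vectors in all charts around \<open>x\<close>,
  transforming by the derivatives of the transition maps, and \<open>0\<close> at all other arguments. Vector
  space operations are pointwise.\<close>

type_synonym 'm tangent = "'m chart \<Rightarrow> real^3"

definition tangent_space :: "'m chart set \<Rightarrow> 'm \<Rightarrow> 'm tangent set" where
  "tangent_space \<A> x = {v. (\<forall>c. c \<notin> charts_at \<A> x \<longrightarrow> v c = 0) \<and>
     (\<forall>c\<in>charts_at \<A> x. \<forall>c'\<in>charts_at \<A> x.
        v c' = frechet_derivative (snd c' \<circ> chart_inv c) (at (snd c x)) (v c))}"

definition smooth_map :: "'m chart set \<Rightarrow> 'm set \<Rightarrow> ('m \<Rightarrow> 'b::real_normed_vector) \<Rightarrow> bool" where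
  "smooth_map \<A> U g \<longleftrightarrow> (\<forall>c\<in>\<A>. smooth_on (snd c ` (U \<inter> fst c)) (g \<circ> chart_inv c))"

definition smooth_vector_field :: "'m chart set \<Rightarrow> 'm set \<Rightarrow> ('m \<Rightarrow> 'm tangent) \<Rightarrow> bool" where
  "smooth_vector_field \<A> U Y \<longleftrightarrow> (\<forall>x\<in>U. Y x \<in> tangent_space \<A> x) \<and>
     (\<forall>c\<in>\<A>. smooth_on (snd c ` (U \<inter> fst c)) (\<lambda>u. Y (chart_inv c u) c))"

text \<open>Derivative at \<open>x\<close> of a vector-valued map \<open>g\<close> in the direction of the tangent vector \<open>v\<close>; it does
  not depend on the chart chosen. For \<open>g = f\<close> this is \<open>f\<^sub>*v\<close>, and for a field \<open>g\<close> along \<open>f\<close> it is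
  \<open>D\<^sub>v g\<close>, \<open>D\<close> being the flat connection.\<close>

definition mderiv :: "'m chart set \<Rightarrow> 'm \<Rightarrow> ('m \<Rightarrow> 'b::real_normed_vector) \<Rightarrow> 'm tangent \<Rightarrow> 'b" where
  "mderiv \<A> x g v = (let c = (SOME c. c \<in> charts_at \<A> x) in
     frechet_derivative (g \<circ> chart_inv c) (at (snd c x)) (v c))"

section \<open>Affine hypersurfaces\<close>

definition immersion :: "'m chart set \<Rightarrow> ('m \<Rightarrow> real^4) \<Rightarrow> bool" where
  "immersion \<A> f \<longleftrightarrow> smooth_map \<A> UNIV f \<and> (\<forall>x. inj_on (mderiv \<A> x f) (tangent_space \<A> x))"

definition tangent_image :: "'m chart set \<Rightarrow> ('m \<Rightarrow> real^4) \<Rightarrow> 'm \<Rightarrow> (real^4) set" where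
  "tangent_image \<A> f x = mderiv \<A> x f ` tangent_space \<A> x"

definition transversal_field :: "'m chart set \<Rightarrow> ('m \<Rightarrow> real^4) \<Rightarrow> ('m \<Rightarrow> real^4) \<Rightarrow> bool" where
  "transversal_field \<A> f C \<longleftrightarrow> smooth_map \<A> UNIV C \<and> (\<forall>x. C x \<notin> tangent_image \<A> f x)"

definition centro_affine :: "'m chart set \<Rightarrow> ('m \<Rightarrow> real^4) \<Rightarrow> bool" where
  "centro_affine \<A> f \<longleftrightarrow> (\<forall>x. f x \<notin> tangent_image \<A> f x)"

text \<open>The value \<open>h\<^sub>x(v,w)\<close> is read off from the formula \<open>D\<^sub>v f\<^sub>*Y = f\<^sub>*(\<nabla>\<^sub>v Y) + h(v,Y) C\<close>, where \<open>Y\<close> is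
  any local smooth extension of \<open>w\<close>; the result does not depend on the extension.\<close>

definition second_fund_form ::
  "('m::topological_space) chart set \<Rightarrow> ('m \<Rightarrow> real^4) \<Rightarrow> ('m \<Rightarrow> real^4) \<Rightarrow> 'm \<Rightarrow> 'm tangent \<Rightarrow> 'm tangent \<Rightarrow> real" where
  "second_fund_form \<A> f C x v w = (THE r. \<exists>U Y. open U \<and> x \<in> U \<and> smooth_vector_field \<A> U Y \<and> Y x = w \<and>
     (\<exists>z\<in>tangent_space \<A> x.
        mderiv \<A> x (\<lambda>y. mderiv \<A> y f (Y y)) v = mderiv \<A> x f z + r *\<^sub>R C x))"

definition shape_operator ::
  "'m chart set \<Rightarrow> ('m \<Rightarrow> real^4) \<Rightarrow> ('m \<Rightarrow> real^4) \<Rightarrow> 'm \<Rightarrow> 'm tangent \<Rightarrow> 'm tangent" where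
  "shape_operator \<A> f C x v = (THE w. w \<in> tangent_space \<A> x \<and>
     (\<exists>t. mderiv \<A> x C v = - mderiv \<A> x f w + t *\<^sub>R C x))"

definition transversal_form ::
  "'m chart set \<Rightarrow> ('m \<Rightarrow> real^4) \<Rightarrow> ('m \<Rightarrow> real^4) \<Rightarrow> 'm \<Rightarrow> 'm tangent \<Rightarrow> real" where
  "transversal_form \<A> f C x v = (THE t. \<exists>w\<in>tangent_space \<A> x.
     mderiv \<A> x C v = - mderiv \<A> x f w + t *\<^sub>R C x)"

text \<open>Passing to another transversal field multiplies \<open>h\<close> by a nowhere vanishing function, so that
  here, and for null-directions below, the choice of \<open>C\<close> is immaterial.\<close>

definition nondegenerate :: "('m::topological_space) chart set \<Rightarrow> ('m \<Rightarrow> real^4) \<Rightarrow> bool" where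
  "nondegenerate \<A> f \<longleftrightarrow> (\<exists>C. transversal_field \<A> f C \<and>
     (\<forall>x. \<forall>v\<in>tangent_space \<A> x.
        (\<forall>w\<in>tangent_space \<A> x. second_fund_form \<A> f C x v w = 0) \<longrightarrow> v = (\<lambda>_. 0)))"

definition induced_volume ::
  "'m chart set \<Rightarrow> ('m \<Rightarrow> real^4) \<Rightarrow> ('m \<Rightarrow> real^4) \<Rightarrow> 'm \<Rightarrow> (3 \<Rightarrow> 'm tangent) \<Rightarrow> real" where
  "induced_volume \<A> f C x X =
     det (vector [mderiv \<A> x f (X 1), mderiv \<A> x f (X 2), mderiv \<A> x f (X 3), C x] :: real^4^4)"

text \<open>The metric volume form, on positively oriented bases only.\<close>

definition metric_volume ::
  "('m::topological_space) chart set \<Rightarrow> ('m \<Rightarrow> real^4) \<Rightarrow> ('m \<Rightarrow> real^4) \<Rightarrow> 'm \<Rightarrow> (3 \<Rightarrow> 'm tangent) \<Rightarrow> real" where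
  "metric_volume \<A> f C x X =
     sqrt \<bar>det ((\<chi> i j. second_fund_form \<A> f C x (X i) (X j)) :: real^3^3)\<bar>"

definition blaschke_field :: "('m::topological_space) chart set \<Rightarrow> ('m \<Rightarrow> real^4) \<Rightarrow> ('m \<Rightarrow> real^4) \<Rightarrow> bool" where
  "blaschke_field \<A> f C \<longleftrightarrow> transversal_field \<A> f C \<and>
     (\<forall>x. \<forall>v\<in>tangent_space \<A> x. transversal_form \<A> f C x v = 0) \<and>
     (\<forall>x X. (\<forall>i. X i \<in> tangent_space \<A> x) \<and> induced_volume \<A> f C x X > 0 \<longrightarrow>
        metric_volume \<A> f C x X = induced_volume \<A> f C x X)"

definition affine_hypersphere :: "('m::topological_space) chart set \<Rightarrow> ('m \<Rightarrow> real^4) \<Rightarrow> bool" where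
  "affine_hypersphere \<A> f \<longleftrightarrow> (\<exists>C l. blaschke_field \<A> f C \<and>
     (\<forall>x. \<forall>v\<in>tangent_space \<A> x. shape_operator \<A> f C x v = (\<lambda>c. l *\<^sub>R v c)))"

text \<open>A quadric \<open>z\<^sup>T Q z + 2 b\<^sup>T z + k = 0\<close> is nondegenerate if the bordered symmetric matrix
  with blocks \<open>Q, b, b\<^sup>T, k\<close> is nonsingular, i.e. has trivial kernel (paraboloids are allowed).\<close>

definition nondegenerate_quadric :: "(real^4) set \<Rightarrow> bool" where
  "nondegenerate_quadric S \<longleftrightarrow> (\<exists>(Q::real^4^4) b k. transpose Q = Q \<and> Q \<noteq> 0 \<and>
     (\<forall>z s. Q *v z + s *\<^sub>R b = 0 \<and> b \<bullet> z + k * s = 0 \<longrightarrow> z = 0 \<and> s = 0) \<and>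
     S = {z. z \<bullet> (Q *v z) + 2 * (b \<bullet> z) + k = 0})"

definition hyperquadric :: "('m \<Rightarrow> real^4) \<Rightarrow> bool" where
  "hyperquadric f \<longleftrightarrow> (\<exists>S. nondegenerate_quadric S \<and> range f \<subseteq> S)"

section \<open>The para-complex structure\<close>

text \<open>Coordinates on \<open>\<real>\<^sup>4\<close> are ordered \<open>(x\<^sub>1, x\<^sub>2, y\<^sub>1, y\<^sub>2)\<close>.\<close>

definition para_J :: "real^4 \<Rightarrow> real^4" where
  "para_J z = vector [z $ 3, z $ 4, z $ 1, z $ 2]"

definition J_tangent :: "'m chart set \<Rightarrow> ('m \<Rightarrow> real^4) \<Rightarrow> ('m \<Rightarrow> real^4) \<Rightarrow> bool" where
  "J_tangent \<A> f C \<longleftrightarrow> (\<forall>x. para_J (C x) \<in> tangent_image \<A> f x)"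

definition dist_D :: "'m chart set \<Rightarrow> ('m \<Rightarrow> real^4) \<Rightarrow> 'm \<Rightarrow> 'm tangent set" where
  "dist_D \<A> f x = {v \<in> tangent_space \<A> x.
     mderiv \<A> x f v \<in> tangent_image \<A> f x \<inter> para_J ` tangent_image \<A> f x}"

definition dist_D_plus :: "'m chart set \<Rightarrow> ('m \<Rightarrow> real^4) \<Rightarrow> 'm \<Rightarrow> 'm tangent set" where
  "dist_D_plus \<A> f x = {v \<in> dist_D \<A> f x. para_J (mderiv \<A> x f v) = mderiv \<A> x f v}"

definition dist_D_minus :: "'m chart set \<Rightarrow> ('m \<Rightarrow> real^4) \<Rightarrow> 'm \<Rightarrow> 'm tangent set" where
  "dist_D_minus \<A> f x = {v \<in> dist_D \<A> f x. para_J (mderiv \<A> x f v) = - mderiv \<A> x f v}"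

definition smooth_line_distribution :: "('m::topological_space) chart set \<Rightarrow> ('m \<Rightarrow> 'm tangent set) \<Rightarrow> bool" where
  "smooth_line_distribution \<A> \<Delta> \<longleftrightarrow> (\<forall>x. \<exists>U Y. open U \<and> x \<in> U \<and> smooth_vector_field \<A> U Y \<and>
     (\<forall>y\<in>U. Y y \<noteq> (\<lambda>_. 0) \<and> \<Delta> y = {(\<lambda>c. t *\<^sub>R Y y c) | t. t \<in> UNIV}))"

definition null_direction :: "('m::topological_space) chart set \<Rightarrow> ('m \<Rightarrow> real^4) \<Rightarrow> ('m \<Rightarrow> 'm tangent set) \<Rightarrow> bool" where
  "null_direction \<A> f \<Delta> \<longleftrightarrow> smooth_line_distribution \<A> \<Delta> \<and>
     (\<exists>C. transversal_field \<A> f C \<and> (\<forall>x. \<forall>v\<in>\<Delta> x. second_fund_form \<A> f C x v v = 0))"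

end

theory Submission
  imports Defs
begin

text \<open>Since the position vector is transversal, every point has a unique conormal \<open>n\<close>: the covector with
  \<open>n \<bullet> f = 1\<close> that kills the tangent space. Differentiating \<open>n \<bullet> f\<^sub>*Y = 0\<close> shows that for
  \<^emph>\<open>any\<close> transversal field \<open>C\<close> the second fundamental form is \<open>- (D\<^sub>v n \<bullet> f\<^sub>*w) / (n \<bullet> C)\<close>
  (\<open>second_fund_form_eq\<close>). So null-directions and nondegeneracy can be read off from the single form
  \<open>h(v,w) = D\<^sub>v n \<bullet> f\<^sub>*w\<close>, which belongs to \<open>C = -f\<close>.

  Let \<open>G\<close> be the matrix, depending on the point, with \<open>G f = n\<close> and \<open>G f\<^sub>*v = D\<^sub>v n\<close>. It is symmetric
  because mixed partial derivatives of \<open>f\<close> commute, and \<open>z \<bullet> G z = 1\<close> is the central quadric that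
  osculates the hypersurface to second order. If \<open>-f\<close> is para-complex tangent, then
  \<open>n \<bullet> J f = 0\<close>, and differentiating this gives \<open>G J f = - J n\<close>. Together with \<open>G f = n\<close> this means that
  \<open>G J + J G\<close> vanishes on \<open>f\<close> and \<open>J f\<close>; on the remaining directions \<open>\<D>\<^sup>+ \<oplus> \<D>\<^sup>-\<close> it vanishes
  exactly when both of them are null (\<open>anticommute_iff_null\<close>).

  Now suppose that they are null, so that \<open>G J = - J G\<close> everywhere. The trilinear form
  \<open>(D\<^sub>u G)(f\<^sub>*v, f\<^sub>*w)\<close> is symmetric in \<open>v, w\<close> since \<open>G\<close> is, and in \<open>u, v\<close> since mixed partial
  derivatives of \<open>f\<close> and of \<open>n\<close> commute. It vanishes as soon as an argument is mapped to \<open>J f\<close>, and, by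
  anticommutation, as soon as two arguments lie in the same \<open>\<D>\<^sup>\<plusminus>\<close>. Among three arguments taken from
  two lines two come from the same line, so \<open>D G = 0\<close> (\<open>dG_eq_0\<close>). As \<open>M\<close> is connected, \<open>G\<close> is
  constant. Then \<open>f \<bullet> G f = 1\<close> is a nondegenerate quadric, and a Gram determinant shows that
  \<open>- r f\<close> is the Blaschke field for the constant \<open>r\<close> with \<open>r\<^sup>5 = \<bar>det G\<bar>\<close>; its shape operator is
  \<open>r I\<close> (\<open>hypersphere_and_quadric\<close>).

  Conversely let \<open>f\<close> lie in a quadric with gradient \<open>2 (Q z + b)\<close>. Then \<open>Q f + b = \<mu> n\<close> with
  \<open>\<mu> \<noteq> 0\<close>, hence \<open>Q = \<mu> h\<close> on tangent vectors. Because \<open>J f\<close> is tangent, \<open>f\<close> also satisfies the quadratic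
  equation \<open>J f \<bullet> (Q f + b) = 0\<close>, and differentiating that one twice gives \<open>J Q + Q J = \<nu> h\<close> on tangent
  vectors. Comparing the two on eigenvectors of \<open>J\<close> forces \<open>\<nu> = 0\<close> and then \<open>h = 0\<close> on each of
  \<open>\<D>\<^sup>+\<close> and \<open>\<D>\<^sup>-\<close> (\<open>quadric_null\<close>).\<close>

section \<open>Calculus of smooth maps\<close>

abbreviation dir_deriv :: "('a::real_normed_vector \<Rightarrow> 'b::real_normed_vector) \<Rightarrow> 'a \<Rightarrow> 'a \<Rightarrow> 'b" where
  "dir_deriv g u \<equiv> frechet_derivative g (at u)"

lemma dir_deriv_eqI: "(g has_derivative g') (at u) \<Longrightarrow> dir_deriv g u = g'"
  using frechet_derivative_at by metis

lemma dir_deriv_cong: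
  assumes "open S" "u \<in> S" "\<And>x. x \<in> S \<Longrightarrow> g x = h x"
  shows "dir_deriv g u = dir_deriv h u"
proof -
  have "(g has_derivative d) (at u) \<longleftrightarrow> (h has_derivative d) (at u)" for d
    using has_derivative_transform_within_open[OF _ assms(1,2), of g d UNIV h]
      has_derivative_transform_within_open[OF _ assms(1,2), of h d UNIV g] assms(3) by auto
  then show ?thesis
    unfolding frechet_derivative_def by simp
qed

lemma differentiable_cong_open:
  assumes "open S" "u \<in> S" "\<And>x. x \<in> S \<Longrightarrow> g x = h x"
  shows "g differentiable (at u) \<longleftrightarrow> h differentiable (at u)"
  unfolding differentiable_def
  using has_derivative_transform_within_open[OF _ assms(1,2), of g _ UNIV h]
      has_derivative_transform_within_open[OF _ assms(1,2), of h _ UNIV g] assms(3) by auto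

lemma Ck_on_cong:
  assumes "open S" "\<And>x. x \<in> S \<Longrightarrow> g x = h x"
  shows "Ck_on k S g \<longleftrightarrow> Ck_on k S h"
  using assms(2)
proof (induction k arbitrary: g h)
  case 0
  then show ?case by (auto intro: continuous_on_cong)
next
  case (Suc k)
  have "Ck_on k S (\<lambda>x. dir_deriv g x v) \<longleftrightarrow> Ck_on k S (\<lambda>x. dir_deriv h x v)" for v
    by (rule Suc.IH) (use dir_deriv_cong[OF assms(1)] Suc.prems in metis)
  then show ?case
    using differentiable_cong_open[OF assms(1) _ Suc.prems] by simp
qed

lemma Ck_on_subset: "Ck_on k S g \<Longrightarrow> T \<subseteq> S \<Longrightarrow> Ck_on k T g"
  by (induction k arbitrary: g) (auto intro: continuous_on_subset)

text \<open>Needed because the product rule uses the factors themselves besides their derivatives.\<close>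
lemma Ck_on_Suc_imp: "Ck_on (Suc k) S g \<Longrightarrow> Ck_on k S g"
proof (induction k arbitrary: g)
  case 0
  then show ?case
    by (auto intro!: differentiable_imp_continuous_on differentiable_at_imp_differentiable_on)
next
  case (Suc k)
  then show ?case by (metis Ck_on.simps(2))
qed

lemma Ck_on_const: "Ck_on k S (\<lambda>x. c)"
  by (induction k arbitrary: c) auto

lemma Ck_on_linear:
  assumes "open S" "bounded_linear L"
  shows "Ck_on k S g \<Longrightarrow> Ck_on k S (\<lambda>x. L (g x))"
proof (induction k arbitrary: g)
  case 0
  then show ?case
    using assms(2) by (simp add: bounded_linear.continuous_on)
next
  case (Suc k)
  have d: "((\<lambda>x. L (g x)) has_derivative (\<lambda>v. L (dir_deriv g x v))) (at x)" if "x \<in> S" for x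
    using Suc.prems that
    by (auto intro!: bounded_linear.has_derivative[OF assms(2)] simp: frechet_derivative_works[symmetric])
  have "Ck_on k S (\<lambda>x. dir_deriv (\<lambda>x. L (g x)) x v)" for v
    using Suc.IH[of "\<lambda>x. dir_deriv g x v"] Suc.prems
    by (subst Ck_on_cong[OF assms(1), of _ "\<lambda>x. L (dir_deriv g x v)"]) (auto simp: dir_deriv_eqI[OF d])
  then show ?case
    using d by (auto simp: differentiable_def)
qed

lemma Ck_on_add:
  assumes "open S"
  shows "Ck_on k S g \<Longrightarrow> Ck_on k S h \<Longrightarrow> Ck_on k S (\<lambda>x. g x + h x)"
proof (induction k arbitrary: g h)
  case 0
  then show ?case by (auto intro: continuous_on_add)
next
  case (Suc k)
  have d: "((\<lambda>x. g x + h x) has_derivative (\<lambda>v. dir_deriv g x v + dir_deriv h x v)) (at x)"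
    if "x \<in> S" for x
    using Suc.prems that
    by (auto intro!: derivative_intros simp: frechet_derivative_works[symmetric])
  have "Ck_on k S (\<lambda>x. dir_deriv (\<lambda>x. g x + h x) x v)" for v
    using Suc.IH[of "\<lambda>x. dir_deriv g x v" "\<lambda>x. dir_deriv h x v"] Suc.prems
    by (subst Ck_on_cong[OF assms(1), of _ "\<lambda>x. dir_deriv g x v + dir_deriv h x v"])
      (auto simp: dir_deriv_eqI[OF d])
  then show ?case
    using d by (auto simp: differentiable_def)
qed

lemma Ck_on_bilinear:
  assumes "open S" "bounded_bilinear bl"
  shows "Ck_on k S g \<Longrightarrow> Ck_on k S h \<Longrightarrow> Ck_on k S (\<lambda>x. bl (g x) (h x))"
proof (induction k arbitrary: g h)
  case 0
  then show ?case using bounded_bilinear.continuous_on[OF assms(2)] by auto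
next
  case (Suc k)
  have d: "((\<lambda>x. bl (g x) (h x)) has_derivative
      (\<lambda>v. bl (g x) (dir_deriv h x v) + bl (dir_deriv g x v) (h x))) (at x)" if "x \<in> S" for x
    using Suc.prems that
    by (auto intro!: bounded_bilinear.FDERIV[OF assms(2)] simp: frechet_derivative_works[symmetric])
  have "Ck_on k S (\<lambda>x. dir_deriv (\<lambda>x. bl (g x) (h x)) x v)" for v
    using Suc.IH[of g "\<lambda>x. dir_deriv h x v"] Suc.IH[of "\<lambda>x. dir_deriv g x v" h]
      Suc.prems Ck_on_Suc_imp[OF Suc.prems(1)] Ck_on_Suc_imp[OF Suc.prems(2)]
    by (subst Ck_on_cong[OF assms(1),
          of _ "\<lambda>x. bl (g x) (dir_deriv h x v) + bl (dir_deriv g x v) (h x)"])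
      (auto simp: dir_deriv_eqI[OF d] intro!: Ck_on_add assms(1))
  then show ?case
    using d by (auto simp: differentiable_def)
qed

lemma Ck_on_inverse:
  fixes g :: "'a::real_normed_vector \<Rightarrow> real"
  assumes "open S" "\<And>x. x \<in> S \<Longrightarrow> g x \<noteq> 0"
  shows "Ck_on k S g \<Longrightarrow> Ck_on k S (\<lambda>x. inverse (g x))"
proof (induction k)
  case 0
  then show ?case using assms by (auto intro: continuous_on_inverse)
next
  case (Suc k)
  have d: "((\<lambda>x. inverse (g x)) has_derivative
      (\<lambda>v. - (inverse (g x) * dir_deriv g x v * inverse (g x)))) (at x)" if "x \<in> S" for x
    using Suc.prems that assms(2)
    by (auto intro!: has_derivative_inverse simp: frechet_derivative_works[symmetric])
  have 1: "Ck_on k S (\<lambda>x. inverse (g x))"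
    using Suc.IH Ck_on_Suc_imp[OF Suc.prems] .
  have 2: "Ck_on k S (\<lambda>x. dir_deriv g x v)" for v
    using Suc.prems by auto
  have "Ck_on k S (\<lambda>x. - (inverse (g x) * dir_deriv g x v * inverse (g x)))" for v
    by (intro Ck_on_linear[OF assms(1) bounded_linear_minus[OF bounded_linear_ident]]
        Ck_on_bilinear[OF assms(1) bounded_bilinear_mult] 1 2)
  then have "Ck_on k S (\<lambda>x. dir_deriv (\<lambda>x. inverse (g x)) x v)" for v
    by (subst Ck_on_cong[OF assms(1)]) (auto simp: dir_deriv_eqI[OF d])
  then show ?case
    using d by (auto simp: differentiable_def)
qed

lemma smooth_on_cong:
  "open S \<Longrightarrow> (\<And>x. x \<in> S \<Longrightarrow> g x = h x) \<Longrightarrow> smooth_on S g \<longleftrightarrow> smooth_on S h"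
  unfolding smooth_on_def by (simp cong: Ck_on_cong)

lemma smooth_on_subset: "smooth_on S g \<Longrightarrow> T \<subseteq> S \<Longrightarrow> smooth_on T g"
  unfolding smooth_on_def by (blast intro: Ck_on_subset)

lemma smooth_on_const [simp, intro]: "smooth_on S (\<lambda>x. c)"
  by (simp add: smooth_on_def Ck_on_const)

lemma smooth_on_linear:
  "open S \<Longrightarrow> bounded_linear L \<Longrightarrow> smooth_on S g \<Longrightarrow> smooth_on S (\<lambda>x. L (g x))"
  by (simp add: smooth_on_def Ck_on_linear)

lemma smooth_on_add:
  "open S \<Longrightarrow> smooth_on S g \<Longrightarrow> smooth_on S h \<Longrightarrow> smooth_on S (\<lambda>x. g x + h x)"
  by (simp add: smooth_on_def Ck_on_add)

lemma smooth_on_bilinear: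
  "open S \<Longrightarrow> bounded_bilinear bl \<Longrightarrow> smooth_on S g \<Longrightarrow> smooth_on S h \<Longrightarrow>
    smooth_on S (\<lambda>x. bl (g x) (h x))"
  by (simp add: smooth_on_def Ck_on_bilinear)

lemma smooth_on_minus: "open S \<Longrightarrow> smooth_on S g \<Longrightarrow> smooth_on S (\<lambda>x. - g x)"
  by (rule smooth_on_linear[OF _ bounded_linear_minus[OF bounded_linear_ident]])

lemma smooth_on_diff:
  "open S \<Longrightarrow> smooth_on S g \<Longrightarrow> smooth_on S h \<Longrightarrow> smooth_on S (\<lambda>x. g x - h x)"
  using smooth_on_add[of S g "\<lambda>x. - h x"] smooth_on_minus[of S h] by simp

lemmas smooth_on_scaleR = smooth_on_bilinear[OF _ bounded_bilinear_scaleR]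
  and smooth_on_mult = smooth_on_bilinear[OF _ bounded_bilinear_mult]
  and smooth_on_inner = smooth_on_bilinear[OF _ bounded_bilinear_inner]

lemma smooth_on_sum:
  "open S \<Longrightarrow> (\<And>i. i \<in> I \<Longrightarrow> smooth_on S (g i)) \<Longrightarrow> smooth_on S (\<lambda>x. \<Sum>i\<in>I. g i x)"
  by (induction I rule: infinite_finite_induct) (auto intro: smooth_on_add)

lemma smooth_on_prod:
  fixes g :: "'i \<Rightarrow> 'a::real_normed_vector \<Rightarrow> real"
  shows "open S \<Longrightarrow> (\<And>i. i \<in> I \<Longrightarrow> smooth_on S (g i)) \<Longrightarrow> smooth_on S (\<lambda>x. \<Prod>i\<in>I. g i x)"
  by (induction I rule: infinite_finite_induct) (auto intro: smooth_on_mult)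

lemma smooth_on_inverse:
  fixes g :: "'a::real_normed_vector \<Rightarrow> real"
  shows "open S \<Longrightarrow> (\<And>x. x \<in> S \<Longrightarrow> g x \<noteq> 0) \<Longrightarrow> smooth_on S g \<Longrightarrow>
    smooth_on S (\<lambda>x. inverse (g x))"
  by (simp add: smooth_on_def Ck_on_inverse)

lemma smooth_on_vec:
  fixes g :: "'a::real_normed_vector \<Rightarrow> 'b::real_normed_vector^'n"
  assumes "open S"
  shows "smooth_on S g \<longleftrightarrow> (\<forall>i. smooth_on S (\<lambda>x. g x $ i))"
proof
  assume "smooth_on S g"
  then show "\<forall>i. smooth_on S (\<lambda>x. g x $ i)"
    using smooth_on_linear[OF assms bounded_linear_vec_nth] by auto
next
  let ?e = "\<lambda>i (a::'b). (\<chi> j. if j = i then a else 0) :: 'b^'n"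
  have L: "bounded_linear (?e i)" for i
  proof (rule bounded_linear_intro[of _ 1])
    fix a :: 'b
    have "norm (?e i a) \<le> (\<Sum>j\<in>UNIV. norm (?e i a $ j))"
      unfolding norm_vec_def by (rule L2_set_le_sum) simp
    then show "norm (?e i a) \<le> norm a * 1"
      by (simp add: if_distrib[of norm] cong: if_cong)
  qed (auto simp: vec_eq_iff)
  assume "\<forall>i. smooth_on S (\<lambda>x. g x $ i)"
  then have "smooth_on S (\<lambda>x. \<Sum>i\<in>UNIV. ?e i (g x $ i))"
    by (intro smooth_on_sum smooth_on_linear[OF assms L] assms) auto
  moreover have "(\<Sum>i\<in>UNIV. ?e i (g x $ i)) = g x" for x
    by (simp add: vec_eq_iff sum_component if_distrib cong: if_cong)
  ultimately show "smooth_on S g" by simp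
qed

lemma smooth_on_det:
  fixes B :: "'a::real_normed_vector \<Rightarrow> real^'n^'n"
  assumes "open S" "\<And>i j. smooth_on S (\<lambda>x. B x $ i $ j)"
  shows "smooth_on S (\<lambda>x. det (B x))"
  unfolding det_def by (intro smooth_on_sum smooth_on_mult smooth_on_prod assms smooth_on_const)

text \<open>Cramer's rule writes the solution of a linear system as a quotient of determinants. All smoothness
  statements about objects that are only characterised by linear equations (conormal, coordinates of
  tangent vectors, osculating quadric) are instances of this.\<close>
lemma smooth_on_solve:
  fixes B :: "'a::real_normed_vector \<Rightarrow> real^'n^'n"
  assumes S: "open S" and B: "smooth_on S B" and b: "smooth_on S b"
    and det: "\<And>x. x \<in> S \<Longrightarrow> det (B x) \<noteq> 0" and y: "\<And>x. x \<in> S \<Longrightarrow> B x *v y x = b x"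
  shows "smooth_on S y"
proof -
  have Bij: "smooth_on S (\<lambda>x. B x $ i $ j)" for i j
    using B[unfolded smooth_on_vec[OF S, where g=B]] smooth_on_vec[OF S, where g="\<lambda>x. B x $ i"] by simp
  have bi: "smooth_on S (\<lambda>x. b x $ i)" for i
    using b smooth_on_vec[OF S] by blast
  have "smooth_on S (\<lambda>x. (\<chi> i j. if j = k then b x $ i else B x $ i $ j) $ i' $ j')" for k i' j'
    by (cases "j' = k") (simp_all add: Bij bi)
  then have "smooth_on S (\<lambda>x. det (\<chi> i j. if j = k then b x $ i else B x $ i $ j) * inverse (det (B x)))" for k
    by (intro smooth_on_mult smooth_on_inverse smooth_on_det S Bij det)
  moreover have "y x $ k = det (\<chi> i j. if j = k then b x $ i else B x $ i $ j) * inverse (det (B x))"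
    if "x \<in> S" for x k
    using cramer[OF det[OF that], of "y x" "b x"] y[OF that] by (simp add: divide_inverse)
  ultimately have "smooth_on S (\<lambda>x. y x $ k)" for k
    by (subst smooth_on_cong[OF S]) auto
  then show ?thesis
    using smooth_on_vec[OF S] by blast
qed

lemma smooth_on_imp_differentiable: "smooth_on S g \<Longrightarrow> x \<in> S \<Longrightarrow> g differentiable (at x)"
  unfolding smooth_on_def by (auto dest: spec[of _ "Suc 0"])

lemma smooth_on_has_derivative:
  "smooth_on S g \<Longrightarrow> x \<in> S \<Longrightarrow> (g has_derivative dir_deriv g x) (at x)"
  using smooth_on_imp_differentiable frechet_derivative_works by blast

lemma smooth_on_dir_deriv: "smooth_on S g \<Longrightarrow> smooth_on S (\<lambda>x. dir_deriv g x v)"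
  unfolding smooth_on_def
proof
  fix k
  assume "\<forall>k. Ck_on k S g"
  then have "Ck_on (Suc k) S g" ..
  then show "Ck_on k S (\<lambda>x. dir_deriv g x v)" by simp
qed

lemma smooth_on_continuous: "smooth_on S g \<Longrightarrow> continuous_on S g"
  unfolding smooth_on_def by (auto dest: spec[of _ 0])

section \<open>Symmetry of second derivatives\<close>

text \<open>The second difference of \<open>g\<close> over a small parallelogram is an increment of \<open>s \<mapsto> g(\<dots> + t b) - g(\<dots>)\<close>;
  the mean value theorem first in direction \<open>a\<close>, then in direction \<open>b\<close>, turns it into a second
  derivative at an intermediate point.\<close>
lemma second_difference_mvt:
  fixes g :: "'a::real_normed_vector \<Rightarrow> real"
  assumes g: "smooth_on S g" and t: "0 < t"
    and S: "\<And>s r. s \<in> {0..t} \<Longrightarrow> r \<in> {0..t} \<Longrightarrow> u + s *\<^sub>R a + r *\<^sub>R b \<in> S"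
  shows "\<exists>s\<in>{0..t}. \<exists>r\<in>{0..t}. g (u + t *\<^sub>R a + t *\<^sub>R b) - g (u + t *\<^sub>R a) - g (u + t *\<^sub>R b) + g u
    = t\<^sup>2 * dir_deriv (\<lambda>x. dir_deriv g x a) (u + s *\<^sub>R a + r *\<^sub>R b) b"
proof -
  let ?p = "\<lambda>s r. u + s *\<^sub>R a + r *\<^sub>R b"
  have line: "((\<lambda>s. k (c + s *\<^sub>R v)) has_derivative (\<lambda>h. h * dir_deriv k (c + s *\<^sub>R v) v)) (at s)"
    if "smooth_on S k" "c + s *\<^sub>R v \<in> S" for k :: "'a \<Rightarrow> real" and c v s
  proof -
    have "((\<lambda>s. c + s *\<^sub>R v) has_derivative (\<lambda>h. h *\<^sub>R v)) (at s)"
      by (auto intro!: derivative_eq_intros)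
    from has_derivative_compose[OF this smooth_on_has_derivative[OF that]]
    show ?thesis
      by (simp add: linear_cmul[OF has_derivative_linear[OF smooth_on_has_derivative[OF that]]])
  qed
  have swap: "(u + r *\<^sub>R b) + s *\<^sub>R a = ?p s r" for s r
    by (simp only: add.assoc add.commute[of "r *\<^sub>R b"])
  let ?phi = "\<lambda>s. g (?p s t) - g (?p s 0)"
  have "\<exists>s\<in>{0<..<t}. ?phi t - ?phi 0 = (t - 0) * (dir_deriv g (?p s t) a - dir_deriv g (?p s 0) a)"
  proof (rule mvt_simple[OF t])
    fix s :: real assume "0 \<le> s" "s \<le> t"
    then have S0: "?p s 0 \<in> S" "?p s t \<in> S"
      using S[of s t] S[of s 0] t by auto
    show "(?phi has_derivative (\<lambda>h. h * (dir_deriv g (?p s t) a - dir_deriv g (?p s 0) a))) (at s within {0..t})"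
      unfolding right_diff_distrib
      by (rule has_derivative_at_withinI, rule has_derivative_diff,
          rule line[OF g, of "u + t *\<^sub>R b" s a, unfolded swap], rule S0,
          rule line[OF g, of "u + 0 *\<^sub>R b" s a, unfolded swap], rule S0)
  qed
  then obtain s where s: "0 < s" "s < t"
    "?phi t - ?phi 0 = t * (dir_deriv g (?p s t) a - dir_deriv g (?p s 0) a)" by auto
  let ?k = "\<lambda>x. dir_deriv g x a"
  have "\<exists>r\<in>{0<..<t}. ?k (?p s t) - ?k (?p s 0) = (t - 0) * dir_deriv ?k (?p s r) b"
  proof (rule mvt_simple[OF t])
    fix r :: real assume "0 \<le> r" "r \<le> t"
    then show "((\<lambda>r. ?k (?p s r)) has_derivative (\<lambda>h. h * dir_deriv ?k (?p s r) b)) (at r within {0..t})"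
      using S[of s r] s
      by (intro has_derivative_at_withinI[OF line[OF smooth_on_dir_deriv[OF g], of "u + s *\<^sub>R a" r b]]) auto
  qed
  then obtain r where r: "0 < r" "r < t" "?k (?p s t) - ?k (?p s 0) = t * dir_deriv ?k (?p s r) b"
    by auto
  have "?phi t - ?phi 0 = t\<^sup>2 * dir_deriv ?k (?p s r) b"
    using s(3) r(3) by (simp add: power2_eq_square)
  then show ?thesis
    using s r by (intro bexI[of _ s] bexI[of _ r]) auto
qed

text \<open>The second difference does not change when \<open>a\<close> and \<open>b\<close> are exchanged. Hence both mixed derivatives,
  taken at suitable points near \<open>u\<close>, agree, and continuity carries this to \<open>u\<close>.\<close>
lemma mixed_partials_real:
  fixes g :: "'a::real_normed_vector \<Rightarrow> real"
  assumes "open S" "smooth_on S g" "u \<in> S"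
  shows "dir_deriv (\<lambda>x. dir_deriv g x a) u b = dir_deriv (\<lambda>x. dir_deriv g x b) u a"
proof -
  obtain e where e: "e > 0" "ball u e \<subseteq> S"
    using assms by (meson openE)
  define M where "M = norm a + norm b + 1"
  \<comment> \<open>the factor 1/2 keeps parallelograms with sides \<open>t n a\<close>, \<open>t n b\<close> strictly inside the ball\<close>
  define t where "t n = e / (2 * M) * inverse (real (Suc n))" for n
  have M: "M > 0" unfolding M_def using norm_ge_zero[of a] norm_ge_zero[of b] by linarith
  have t0: "t n > 0" for n
    using e M by (simp add: t_def)
  have tM: "t n * M < e" for n
  proof -
    have "t n * M = e / 2 * inverse (real (Suc n))"
    proof -
      have "e / (2 * M) * i * M = e / 2 * i" for i
        using M by (simp add: field_simps)
      then show ?thesis unfolding t_def .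
    qed
    also have "\<dots> \<le> e / 2 * 1"
      using e by (intro mult_left_mono) (auto simp: field_simps)
    finally show ?thesis using e by simp
  qed
  have inb: "u + s *\<^sub>R c + r *\<^sub>R d \<in> S"
    if "s \<in> {0..t n}" "r \<in> {0..t n}" "norm c + norm d + 1 = M" for s r n c d
  proof -
    have "norm (s *\<^sub>R c + r *\<^sub>R d) \<le> s * norm c + r * norm d"
      using norm_triangle_ineq[of "s *\<^sub>R c" "r *\<^sub>R d"] that by simp
    also have "\<dots> \<le> t n * norm c + t n * norm d"
      using that by (intro add_mono mult_right_mono) auto
    also have "\<dots> \<le> t n * M"
      using t0[of n] by (subst distrib_left[symmetric], intro mult_left_mono) (auto simp flip: that(3))
    finally have "dist (u + (s *\<^sub>R c + r *\<^sub>R d)) u < e"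
      using tM[of n] by (simp add: dist_norm)
    then have "u + (s *\<^sub>R c + r *\<^sub>R d) \<in> ball u e"
      by (simp only: mem_ball dist_commute)
    then show ?thesis using e(2) by (auto simp: add.assoc)
  qed
  have "\<exists>s r. \<forall>n. s n \<in> {0..t n} \<and> r n \<in> {0..t n} \<and>
     g (u + t n *\<^sub>R c + t n *\<^sub>R d) - g (u + t n *\<^sub>R c) - g (u + t n *\<^sub>R d) + g u
    = (t n)\<^sup>2 * dir_deriv (\<lambda>x. dir_deriv g x c) (u + s n *\<^sub>R c + r n *\<^sub>R d) d"
    if "norm c + norm d + 1 = M" for c d
  proof -
    have "\<forall>n. \<exists>s r. s \<in> {0..t n} \<and> r \<in> {0..t n} \<and>
       g (u + t n *\<^sub>R c + t n *\<^sub>R d) - g (u + t n *\<^sub>R c) - g (u + t n *\<^sub>R d) + g u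
      = (t n)\<^sup>2 * dir_deriv (\<lambda>x. dir_deriv g x c) (u + s *\<^sub>R c + r *\<^sub>R d) d"
    proof
      fix n
      show "\<exists>s r. s \<in> {0..t n} \<and> r \<in> {0..t n} \<and>
       g (u + t n *\<^sub>R c + t n *\<^sub>R d) - g (u + t n *\<^sub>R c) - g (u + t n *\<^sub>R d) + g u
      = (t n)\<^sup>2 * dir_deriv (\<lambda>x. dir_deriv g x c) (u + s *\<^sub>R c + r *\<^sub>R d) d"
        using second_difference_mvt[OF assms(2) t0[of n] inb[OF _ _ that, of _ n]]
        by (simp only: Bex_def conj_assoc ex_simps)
    qed
    from choice[OF this] obtain s where "\<forall>n. \<exists>r. s n \<in> {0..t n} \<and> r \<in> {0..t n} \<and>
       g (u + t n *\<^sub>R c + t n *\<^sub>R d) - g (u + t n *\<^sub>R c) - g (u + t n *\<^sub>R d) + g u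
      = (t n)\<^sup>2 * dir_deriv (\<lambda>x. dir_deriv g x c) (u + s n *\<^sub>R c + r *\<^sub>R d) d" ..
    from choice[OF this] show ?thesis by blast
  qed
  note * = this
  have t_lim: "t \<longlonglongrightarrow> 0"
    unfolding t_def using tendsto_mult_right_zero[OF LIMSEQ_inverse_real_of_nat] .
  have lim: "(\<lambda>n. dir_deriv (\<lambda>x. dir_deriv g x c) (u + s n *\<^sub>R c + r n *\<^sub>R d) d)
      \<longlonglongrightarrow> dir_deriv (\<lambda>x. dir_deriv g x c) u d"
    if "\<And>n. s n \<in> {0..t n}" "\<And>n. r n \<in> {0..t n}" for s r c d
  proof -
    have "s \<longlonglongrightarrow> 0" "r \<longlonglongrightarrow> 0"
      using that by (auto intro!: tendsto_sandwich[OF _ _ tendsto_const t_lim])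
    then have "(\<lambda>n. u + s n *\<^sub>R c + r n *\<^sub>R d) \<longlonglongrightarrow> u + 0 *\<^sub>R c + 0 *\<^sub>R d"
      by (intro tendsto_intros)
    moreover have "isCont (\<lambda>x. dir_deriv (\<lambda>x. dir_deriv g x c) x d) u"
      using smooth_on_continuous[OF smooth_on_dir_deriv[OF smooth_on_dir_deriv[OF assms(2)]]]
        assms(1,3) by (simp add: continuous_on_eq_continuous_at)
    ultimately show ?thesis
      by (auto intro: isCont_tendsto_compose)
  qed
  obtain s r where 1: "\<And>n. s n \<in> {0..t n}" "\<And>n. r n \<in> {0..t n}"
     "\<And>n. g (u + t n *\<^sub>R a + t n *\<^sub>R b) - g (u + t n *\<^sub>R a) - g (u + t n *\<^sub>R b) + g u
    = (t n)\<^sup>2 * dir_deriv (\<lambda>x. dir_deriv g x a) (u + s n *\<^sub>R a + r n *\<^sub>R b) b"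
    using *[of a b] by (auto simp: M_def)
  obtain s' r' where 2: "\<And>n. s' n \<in> {0..t n}" "\<And>n. r' n \<in> {0..t n}"
     "\<And>n. g (u + t n *\<^sub>R b + t n *\<^sub>R a) - g (u + t n *\<^sub>R b) - g (u + t n *\<^sub>R a) + g u
    = (t n)\<^sup>2 * dir_deriv (\<lambda>x. dir_deriv g x b) (u + s' n *\<^sub>R b + r' n *\<^sub>R a) a"
    using *[of b a] by (auto simp: M_def)
  have "(t n)\<^sup>2 * dir_deriv (\<lambda>x. dir_deriv g x a) (u + s n *\<^sub>R a + r n *\<^sub>R b) b
    = (t n)\<^sup>2 * dir_deriv (\<lambda>x. dir_deriv g x b) (u + s' n *\<^sub>R b + r' n *\<^sub>R a) a" for n
    using 1(3)[of n] 2(3)[of n] by (simp add: algebra_simps)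
  note eq = this
  have "dir_deriv (\<lambda>x. dir_deriv g x a) (u + s n *\<^sub>R a + r n *\<^sub>R b) b
    = dir_deriv (\<lambda>x. dir_deriv g x b) (u + s' n *\<^sub>R b + r' n *\<^sub>R a) a" for n
    using eq[of n] t0[of n] by simp
  then show ?thesis
    using LIMSEQ_unique[OF lim[OF 1(1,2), of a b]] lim[OF 2(1,2), of b a] by simp
qed

lemma dir_deriv_component:
  assumes "g differentiable (at u)"
  shows "dir_deriv (\<lambda>x. g x $ i) u a = dir_deriv g u a $ i"
  using dir_deriv_eqI[OF bounded_linear.has_derivative[OF bounded_linear_vec_nth
        assms[unfolded frechet_derivative_works], of i]] by simp

lemma mixed_partials:
  fixes g :: "'a::real_normed_vector \<Rightarrow> real^'n"
  assumes S: "open S" and g: "smooth_on S g" and u: "u \<in> S"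
  shows "dir_deriv (\<lambda>x. dir_deriv g x a) u b = dir_deriv (\<lambda>x. dir_deriv g x b) u a"
proof -
  have 1: "dir_deriv (\<lambda>x. dir_deriv (\<lambda>x. g x $ i) x a) u b = dir_deriv (\<lambda>x. dir_deriv g x a) u b $ i"
    for a b i
    using dir_deriv_cong[OF S u, of "\<lambda>x. dir_deriv (\<lambda>x. g x $ i) x a" "\<lambda>x. dir_deriv g x a $ i"]
      dir_deriv_component[OF smooth_on_imp_differentiable[OF g]]
      dir_deriv_component[OF smooth_on_imp_differentiable[OF smooth_on_dir_deriv[OF g] u], of a i b] by simp
  have "smooth_on S (\<lambda>x. g x $ i)" for i
    using g smooth_on_vec[OF S] by blast
  from mixed_partials_real[OF S this u, of _ a b] show ?thesis
    by (simp add: vec_eq_iff 1)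
qed

section \<open>Linear algebra in \<open>\<real>\<^sup>4\<close> and the para-complex structure\<close>
lemma inner_4: "(z::real^4) \<bullet> w = z$1 * w$1 + z$2 * w$2 + z$3 * w$3 + z$4 * w$4"
  by (simp add: inner_vec_def sum_4)

lemma vector_4 [simp]:
  "(vector [x,y,z,w] :: 'a::zero^4)$1 = x" "(vector [x,y,z,w] :: 'a^4)$2 = y"
  "(vector [x,y,z,w] :: 'a^4)$3 = z" "(vector [x,y,z,w] :: 'a^4)$4 = w"
  unfolding vector_def by simp_all

lemma para_J_nth [simp]:
  "para_J z $ 1 = z $ 3" "para_J z $ 2 = z $ 4" "para_J z $ 3 = z $ 1" "para_J z $ 4 = z $ 2"
  by (simp_all add: para_J_def)

lemma bounded_linear_para_J: "bounded_linear para_J"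
  unfolding linear_conv_bounded_linear[symmetric]
  by (rule linearI) (simp_all add: vec_eq_iff forall_4)

lemma linear_para_J: "linear para_J"
  using bounded_linear_para_J by (simp add: linear_conv_bounded_linear)

lemmas para_J_add = linear_add[OF linear_para_J] and para_J_diff = linear_diff[OF linear_para_J]
  and para_J_scaleR = linear_cmul[OF linear_para_J] and para_J_minus = linear_neg[OF linear_para_J]
  and para_J_0 = linear_0[OF linear_para_J]

lemma para_J_para_J [simp]: "para_J (para_J z) = z"
  by (simp add: vec_eq_iff forall_4)

lemma para_J_inner: "para_J z \<bullet> w = z \<bullet> para_J w"
  by (simp add: inner_4)

lemma dir_deriv_linear: "smooth_on S g \<Longrightarrow> u \<in> S \<Longrightarrow> linear (dir_deriv g u)"
  by (blast intro: smooth_on_has_derivative has_derivative_linear)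

lemma dir_deriv_axis_sum:
  fixes g :: "real^3 \<Rightarrow> 'b::real_normed_vector"
  assumes "linear (dir_deriv g u)"
  shows "dir_deriv g u a = (\<Sum>i\<in>UNIV. a $ i *\<^sub>R dir_deriv g u (axis i 1))"
proof -
  have "dir_deriv g u a = dir_deriv g u (\<Sum>i\<in>UNIV. a $ i *\<^sub>R axis i 1)"
    using basis_expansion[of a] by (simp add: scalar_mult_eq_scaleR)
  then show ?thesis
    by (simp add: linear_sum[OF assms] linear_cmul[OF assms])
qed

text \<open>Every structure equation below comes from differentiating a relation \<open>p \<bullet> q = const\<close>.\<close>
lemma inner_const_dir_deriv:
  fixes p q :: "'a::real_normed_vector \<Rightarrow> 'b::real_inner"
  assumes "open S" "u \<in> S" "p differentiable (at u)" "q differentiable (at u)"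
    and c: "\<And>x. x \<in> S \<Longrightarrow> p x \<bullet> q x = c"
  shows "dir_deriv p u a \<bullet> q u = - (p u \<bullet> dir_deriv q u a)"
proof -
  have "((\<lambda>x. p x \<bullet> q x) has_derivative (\<lambda>h. p u \<bullet> dir_deriv q u h + dir_deriv p u h \<bullet> q u)) (at u)"
    using assms(3,4) by (auto intro!: has_derivative_inner simp: frechet_derivative_works[symmetric])
  then have "dir_deriv (\<lambda>x. p x \<bullet> q x) u a = p u \<bullet> dir_deriv q u a + dir_deriv p u a \<bullet> q u"
    by (simp add: dir_deriv_eqI)
  moreover have "dir_deriv (\<lambda>x. p x \<bullet> q x) u = dir_deriv (\<lambda>x. c) u"
    by (rule dir_deriv_cong[OF assms(1,2) c])
  ultimately show ?thesis
    by simp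
qed

lemma smooth_on_nth: "open S \<Longrightarrow> smooth_on S g \<Longrightarrow> smooth_on S (\<lambda>x. g x $ i)"
  by (rule smooth_on_linear[OF _ bounded_linear_vec_nth])

lemma bounded_bilinear_matrix_vector: "bounded_bilinear ((*v) :: real^'n^'m \<Rightarrow> real^'n \<Rightarrow> real^'m)"
  unfolding bilinear_conv_bounded_bilinear[symmetric] bilinear_def
  by (auto intro!: linearI simp: algebra_simps matrix_scaleR_vector_ac vec_eq_iff
      matrix_vector_mult_def sum.distrib sum_distrib_left)

lemma inner_eq_imp_eq:
  fixes y z :: "'a::real_inner" shows "(\<And>w. w \<bullet> y = w \<bullet> z) \<Longrightarrow> y = z"
  by (metis inner_commute vector_eq_ldot)

section \<open>Centro-affine hypersurfaces in a coordinate patch\<close>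

text \<open>\<open>F\<close> is a hypersurface written in coordinates and \<open>N\<close> its conormal. The existence of \<open>N\<close> encodes that
  the position vector is transversal; smoothness of \<open>N\<close> is then automatic.\<close>
locale centroaffine_patch =
  fixes W :: "(real^3) set" and F N :: "real^3 \<Rightarrow> real^4"
  assumes open_W: "open W" and smooth_F: "smooth_on W F"
    and immersed: "u \<in> W \<Longrightarrow> dir_deriv F u a = 0 \<Longrightarrow> a = 0"
    and N_F: "u \<in> W \<Longrightarrow> N u \<bullet> F u = 1"
    and N_tangent: "u \<in> W \<Longrightarrow> N u \<bullet> dir_deriv F u a = 0"
begin

lemma linear_dF: "u \<in> W \<Longrightarrow> linear (dir_deriv F u)"
  using dir_deriv_linear smooth_F by blast

text \<open>The position vector and the tangent vectors span, since the map \<open>y \<mapsto> y\<^sub>4 F + dF(y\<^sub>1, y\<^sub>2, y\<^sub>3)\<close>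
  is injective: \<open>N\<close> recovers \<open>y\<^sub>4\<close>, and \<open>F\<close> is an immersion.\<close>
lemma decomposition:
  assumes u: "u \<in> W"
  obtains a where "z = (N u \<bullet> z) *\<^sub>R F u + dir_deriv F u a"
proof -
  define L :: "real^4 \<Rightarrow> real^4" where "L y = y $ 4 *\<^sub>R F u + dir_deriv F u (vector [y $ 1, y $ 2, y $ 3])" for y
  have v: "(vector [a + a', b + b', c + c'] :: real^3) = vector [a,b,c] + vector [a',b',c']"
    "(vector [r * a, r * b, r * c] :: real^3) = r *\<^sub>R vector [a,b,c]" for a a' b b' c c' r :: real
    by (simp_all add: vec_eq_iff forall_3)
  have L: "linear L"
    by (rule linearI) (simp_all add: L_def v linear_add[OF linear_dF[OF u]] linear_cmul[OF linear_dF[OF u]] algebra_simps)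
  have N_L: "N u \<bullet> L y = y $ 4" for y
    using N_F[OF u] N_tangent[OF u] by (simp add: L_def inner_right_distrib)
  have "inj L"
    unfolding linear_inj_iff_eq_0[OF L]
  proof (intro allI impI)
    fix y assume "L y = 0"
    then have y4: "y $ 4 = 0" using N_L[of y] by simp
    then have "vector [y $ 1, y $ 2, y $ 3] = (0::real^3)"
      using \<open>L y = 0\<close> immersed[OF u] by (simp add: L_def)
    with y4 show "y = 0" by (simp add: vec_eq_iff forall_3 forall_4)
  qed
  then have "surj L"
    using linear_injective_imp_surjective[OF L] by blast
  then obtain y where "z = L y" by (meson surjD)
  with N_L[of y] that show thesis by (simp add: L_def)
qed

lemma tangent_iff:
  assumes u: "u \<in> W"
  shows "N u \<bullet> z = 0 \<longleftrightarrow> z \<in> range (dir_deriv F u)"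
proof
  assume "N u \<bullet> z = 0"
  moreover obtain a where "z = (N u \<bullet> z) *\<^sub>R F u + dir_deriv F u a"
    by (rule decomposition[OF u])
  ultimately show "z \<in> range (dir_deriv F u)" by simp
qed (use N_tangent[OF u] in auto)

definition frame :: "real^3 \<Rightarrow> real^4^4" where
  "frame u = vector [dir_deriv F u (axis 1 1), dir_deriv F u (axis 2 1), dir_deriv F u (axis 3 1), F u]"

lemma dF_frame:
  assumes u: "u \<in> W"
  shows "dir_deriv F u a = a $ 1 *\<^sub>R frame u $ 1 + a $ 2 *\<^sub>R frame u $ 2 + a $ 3 *\<^sub>R frame u $ 3"
  by (subst dir_deriv_axis_sum[OF linear_dF[OF u]]) (simp add: frame_def sum_3)

lemma frame_mult: "frame u *v z = vector [dir_deriv F u (axis 1 1) \<bullet> z, dir_deriv F u (axis 2 1) \<bullet> z,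
    dir_deriv F u (axis 3 1) \<bullet> z, F u \<bullet> z]"
  by (simp add: vec_eq_iff forall_4 matrix_vector_mul_component frame_def)

lemma det_frame:
  assumes u: "u \<in> W"
  shows "det (frame u) \<noteq> 0"
proof -
  have "z = 0" if "frame u *v z = 0" for z
  proof -
    have 0: "frame u $ i \<bullet> z = 0" for i
      using that by (metis matrix_vector_mul_component zero_index)
    have "w \<bullet> z = w \<bullet> 0" for w
    proof -
      obtain a where "w = (N u \<bullet> w) *\<^sub>R frame u $ 4 + dir_deriv F u a"
        using decomposition[OF u, of w] by (auto simp: frame_def)
      then have "w \<bullet> z = ((N u \<bullet> w) *\<^sub>R frame u $ 4 + dir_deriv F u a) \<bullet> z" by simp
      then show ?thesis
        by (simp add: dF_frame[OF u] inner_left_distrib 0)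
    qed
    then show ?thesis by (rule inner_eq_imp_eq)
  qed
  then show ?thesis
    by (simp add: invertible_det_nz[symmetric] invertible_left_inverse matrix_left_invertible_ker)
qed

lemma smooth_frame: "smooth_on W frame"
  unfolding smooth_on_vec[OF open_W, where g=frame]
  by (simp add: forall_4 frame_def smooth_F smooth_on_dir_deriv)

lemma smooth_on_frame_solve:
  assumes "\<And>u. u \<in> W \<Longrightarrow> frame u *v y u = b u" "smooth_on W b"
  shows "smooth_on W y"
  using smooth_on_solve[OF open_W smooth_frame assms(2) det_frame assms(1)] .

lemma smooth_N: "smooth_on W N"
  by (rule smooth_on_frame_solve[where b="\<lambda>_. vector [0,0,0,1]"])
    (simp_all add: frame_mult N_F N_tangent inner_commute[of _ "N _"])

text \<open>Padding with a zero coordinate along \<open>F\<close> makes \<open>dF y = E\<close> a square system, with the transposed frame.\<close>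
lemma smooth_coordinates:
  assumes E: "smooth_on S E" and S: "open S" "S \<subseteq> W"
    and y: "\<And>u. u \<in> S \<Longrightarrow> dir_deriv F u (y u) = E u"
  shows "smooth_on S y"
proof -
  have tr: "transpose (frame u) *v vector [a $ 1, a $ 2, a $ 3, 0] = dir_deriv F u a" if "u \<in> W" for u a
    unfolding dF_frame[OF that]
    by (simp add: vec_eq_iff matrix_vector_mult_def sum_4 transpose_def algebra_simps)
  have "smooth_on S (\<lambda>u. transpose (frame u))"
    using smooth_on_subset[OF smooth_frame S(2)]
    by (simp add: smooth_on_vec[OF S(1)] transpose_def)
  moreover have "det (transpose (frame u)) \<noteq> 0" if "u \<in> S" for u
    using det_frame that S by (auto simp: det_transpose)
  moreover have "transpose (frame u) *v vector [y u $ 1, y u $ 2, y u $ 3, 0] = E u" if "u \<in> S" for u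
    using tr y that S by auto
  ultimately have "smooth_on S (\<lambda>u. vector [y u $ 1, y u $ 2, y u $ 3, 0] :: real^4)"
    by (rule smooth_on_solve[OF S(1) _ E])
  then have "\<forall>i. smooth_on S (\<lambda>u. (vector [y u $ 1, y u $ 2, y u $ 3, 0] :: real^4) $ i)"
    by (rule iffD1[OF smooth_on_vec[OF S(1)]])
  then show ?thesis
    by (simp add: smooth_on_vec[OF S(1), where g=y] forall_3 forall_4)
qed

text \<open>The second fundamental form relative to the transversal field \<open>-F\<close>.\<close>
abbreviation "affine_metric u a b \<equiv> dir_deriv N u a \<bullet> dir_deriv F u b"

lemma diff_F: "u \<in> W \<Longrightarrow> F differentiable (at u)"
  and diff_N: "u \<in> W \<Longrightarrow> N differentiable (at u)"
  and diff_dF: "u \<in> W \<Longrightarrow> (\<lambda>x. dir_deriv F x b) differentiable (at u)"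
  using smooth_F smooth_N smooth_on_dir_deriv[OF smooth_F] smooth_on_imp_differentiable by blast+

lemma dN_F: "u \<in> W \<Longrightarrow> dir_deriv N u a \<bullet> F u = 0"
  using inner_const_dir_deriv[OF open_W _ diff_N diff_F, of u 1 a] N_F N_tangent by simp

lemma metric_eq: "u \<in> W \<Longrightarrow> affine_metric u a b = - (N u \<bullet> dir_deriv (\<lambda>x. dir_deriv F x b) u a)"
  using inner_const_dir_deriv[OF open_W _ diff_N diff_dF, of u b 0 a] N_tangent by simp

lemma metric_sym: "u \<in> W \<Longrightarrow> affine_metric u a b = affine_metric u b a"
  using metric_eq mixed_partials[OF open_W smooth_F] by simp

text \<open>The conditions prescribe a linear map on \<open>F\<close> and on the tangent space, which are complementary; \<open>t\<close>
  below is the projection along \<open>F\<close>, read in coordinates.\<close>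
lemma ex_osculating_matrix:
  assumes u: "u \<in> W"
  shows "\<exists>A :: real^4^4. A *v F u = N u \<and> (\<forall>a. A *v dir_deriv F u a = dir_deriv N u a)"
proof -
  note lin = linear_dF[OF u] and linN = dir_deriv_linear[OF smooth_N u]
  have "\<exists>t. \<forall>z. z = (N u \<bullet> z) *\<^sub>R F u + dir_deriv F u (t z)"
    by (rule choice) (use decomposition[OF u] in metis)
  then obtain t where t: "\<And>z. dir_deriv F u (t z) = z - (N u \<bullet> z) *\<^sub>R F u"
    by (metis add_diff_cancel_left')
  have inj: "a = b" if "dir_deriv F u a = dir_deriv F u b" for a b
    using immersed[OF u, of "a - b"] that by (simp add: linear_diff[OF lin])
  have t_lin: "linear t"
  proof (rule linearI)
    show "t (y + z) = t y + t z" for y z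
      by (rule inj) (simp add: t linear_add[OF lin] inner_right_distrib algebra_simps)
    show "t (r *\<^sub>R z) = r *\<^sub>R t z" for r z
      by (rule inj) (simp add: t linear_cmul[OF lin] algebra_simps)
  qed
  define A where "A = matrix (\<lambda>z. (N u \<bullet> z) *\<^sub>R N u + dir_deriv N u (t z))"
  have "linear (\<lambda>z. (N u \<bullet> z) *\<^sub>R N u + dir_deriv N u (t z))"
    by (rule linearI) (simp_all add: linear_add[OF t_lin] linear_cmul[OF t_lin]
        linear_add[OF linN] linear_cmul[OF linN] inner_right_distrib algebra_simps)
  then have A: "A *v z = (N u \<bullet> z) *\<^sub>R N u + dir_deriv N u (t z)" for z
    unfolding A_def by (simp add: matrix_works)
  have "t (F u) = 0"
    by (rule inj) (simp add: t N_F[OF u] linear_0[OF lin])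
  moreover have "t (dir_deriv F u a) = a" for a
    by (rule inj) (simp add: t N_tangent[OF u])
  ultimately show ?thesis
    by (intro exI[of _ A]) (simp add: A N_F[OF u] N_tangent[OF u] linear_0[OF linN])
qed

end

text \<open>The quadric \<open>z \<bullet> G z = 1\<close> contains the point \<open>F\<close> and has there the same conormal and the same second
  fundamental form as the hypersurface.\<close>
locale osculating_patch = centroaffine_patch +
  fixes G :: "real^3 \<Rightarrow> real^4^4"
  assumes G_F: "u \<in> W \<Longrightarrow> G u *v F u = N u"
    and G_dF: "u \<in> W \<Longrightarrow> G u *v dir_deriv F u a = dir_deriv N u a"
begin

text \<open>On tangent vectors \<open>G\<close> is the second fundamental form, on \<open>F\<close> it is \<open>1\<close>, and the two are
  orthogonal for \<open>G\<close> because \<open>dN \<bullet> F = 0 = N \<bullet> dF\<close>.\<close>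
lemma G_sym:
  assumes u: "u \<in> W"
  shows "z \<bullet> (G u *v w) = w \<bullet> (G u *v z)"
proof -
  obtain a b where a: "z = (N u \<bullet> z) *\<^sub>R F u + dir_deriv F u a"
    and b: "w = (N u \<bullet> w) *\<^sub>R F u + dir_deriv F u b"
    using decomposition[OF u] by metis
  have "(r *\<^sub>R F u + dir_deriv F u a) \<bullet> (G u *v (s *\<^sub>R F u + dir_deriv F u b)) = r * s + affine_metric u a b" for r s a b
    using N_F[OF u] N_tangent[OF u] dN_F[OF u] metric_sym[OF u]
    by (simp add: matrix_vector_right_distrib matrix_vector_mult_scaleR G_F[OF u] G_dF[OF u]
        inner_left_distrib inner_right_distrib inner_commute)
  then show ?thesis
    using a b metric_sym[OF u, of a b] by (metis mult.commute)
qed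

lemma smooth_G: "smooth_on W G"
  unfolding smooth_on_vec[OF open_W, where g=G]
proof
  fix k
  show "smooth_on W (\<lambda>u. G u $ k)"
  proof (rule smooth_on_frame_solve)
    show "frame u *v G u $ k = vector [dir_deriv N u (axis 1 1) $ k, dir_deriv N u (axis 2 1) $ k,
        dir_deriv N u (axis 3 1) $ k, N u $ k]" if "u \<in> W" for u
      by (simp add: frame_mult flip: G_F[OF that] G_dF[OF that])
        (simp add: matrix_vector_mul_component inner_commute)
    have "smooth_on W (\<lambda>u. dir_deriv N u a $ k)" "smooth_on W (\<lambda>u. N u $ k)" for a
      by (simp_all add: smooth_on_nth[OF open_W] smooth_on_dir_deriv smooth_N)
    then show "smooth_on W (\<lambda>u. vector [dir_deriv N u (axis 1 1) $ k, dir_deriv N u (axis 2 1) $ k,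
        dir_deriv N u (axis 3 1) $ k, N u $ k] :: real^4)"
      by (simp add: smooth_on_vec[OF open_W] forall_4)
  qed
qed

lemma diff_G: "u \<in> W \<Longrightarrow> G differentiable (at u)"
  using smooth_G smooth_on_imp_differentiable by blast

lemma dG_mult:
  assumes "u \<in> W" "y differentiable (at u)"
  shows "dir_deriv (\<lambda>x. G x *v y x) u a = G u *v dir_deriv y u a + dir_deriv G u a *v y u"
  using dir_deriv_eqI[OF bounded_bilinear.FDERIV[OF bounded_bilinear_matrix_vector
        diff_G[OF assms(1), unfolded frechet_derivative_works] assms(2)[unfolded frechet_derivative_works]]]
  by simp

lemma dG_F:
  assumes u: "u \<in> W"
  shows "dir_deriv G u a *v F u = 0"
  using dG_mult[OF u diff_F[OF u], of a] G_dF[OF u, of a]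
    dir_deriv_cong[OF open_W u, of "\<lambda>x. G x *v F x" N] G_F by simp

text \<open>Differentiate \<open>G dF(b) = dN(b)\<close> in direction \<open>a\<close>; everything except \<open>(D\<^sub>a G) dF(b)\<close> is symmetric in
  \<open>a\<close> and \<open>b\<close>.\<close>
lemma dG_dF:
  assumes u: "u \<in> W"
  shows "dir_deriv G u a *v dir_deriv F u b = dir_deriv G u b *v dir_deriv F u a"
proof -
  have "G u *v dir_deriv (\<lambda>x. dir_deriv F x b) u a + dir_deriv G u a *v dir_deriv F u b
      = dir_deriv (\<lambda>x. dir_deriv N x b) u a" for a b
    using dG_mult[OF u diff_dF[OF u, of b], of a]
      dir_deriv_cong[OF open_W u, of "\<lambda>x. G x *v dir_deriv F x b" "\<lambda>x. dir_deriv N x b"] G_dF by simp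
  from this[of a b] this[of b a] show ?thesis
    using mixed_partials[OF open_W smooth_F u, of a b] mixed_partials[OF open_W smooth_N u, of a b]
    by (metis add_left_cancel)
qed

text \<open>Linear relations that hold identically for \<open>G\<close> pass to its derivative.\<close>
lemma dG_const:
  fixes L :: "real^4^4 \<Rightarrow> 'b::real_normed_vector"
  assumes u: "u \<in> W" and L: "linear L" "\<And>x. x \<in> W \<Longrightarrow> L (G x) = 0"
  shows "L (dir_deriv G u a) = 0"
proof -
  have "bounded_linear L"
    using L(1) linear_conv_bounded_linear by blast
  from bounded_linear.has_derivative[OF this diff_G[OF u, unfolded frechet_derivative_works]]
  have "dir_deriv (\<lambda>x. L (G x)) u a = L (dir_deriv G u a)"
    by (simp add: dir_deriv_eqI)
  then show ?thesis
    using dir_deriv_cong[OF open_W u, of "\<lambda>x. L (G x)" "\<lambda>x. 0"] L(2) by simp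
qed

lemma dG_sym:
  assumes u: "u \<in> W"
  shows "z \<bullet> (dir_deriv G u a *v w) = w \<bullet> (dir_deriv G u a *v z)"
proof -
  have "linear (\<lambda>A :: real^4^4. z \<bullet> (A *v w) - w \<bullet> (A *v z))"
    by (rule linearI) (simp_all add: matrix_vector_mult_add_rdistrib scaleR_matrix_vector_assoc[symmetric]
        inner_right_distrib algebra_simps)
  from dG_const[OF u this, of a] G_sym show ?thesis by simp
qed

end

section \<open>Rigidity of the osculating quadric\<close>
definition plus_part where "plus_part z = (1/2) *\<^sub>R (z + para_J z)"
definition minus_part where "minus_part z = (1/2) *\<^sub>R (z - para_J z)"

lemma parts_sum: "z = plus_part z + minus_part z"
  by (simp add: plus_part_def minus_part_def algebra_simps flip: scaleR_add_left)

lemma para_J_plus_part [simp]: "para_J (plus_part z) = plus_part z"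
  and para_J_minus_part [simp]: "para_J (minus_part z) = - minus_part z"
  by (simp_all add: plus_part_def minus_part_def para_J_scaleR para_J_add para_J_diff algebra_simps)

text \<open>A point \<open>f\<close> with conormal \<open>n\<close> such that \<open>J f\<close> is tangent. The kernel of \<open>n\<close> then meets each
  eigenplane of \<open>J\<close> in a line, and these two lines together with \<open>f\<close> and \<open>J f\<close> span the space.\<close>
locale J_symmetric_point =
  fixes f n :: "real^4"
  assumes n_f: "n \<bullet> f = 1" and n_Jf: "n \<bullet> para_J f = 0"
begin

lemma n_parts_f: "n \<bullet> plus_part f = 1/2" "n \<bullet> minus_part f = 1/2"
  using n_f n_Jf by (simp_all add: plus_part_def minus_part_def inner_right_distrib inner_diff_right)

lemma eigen_decomposition:
  obtains s t p m where "z = s *\<^sub>R f + t *\<^sub>R para_J f + p + m" "para_J p = p" "n \<bullet> p = 0"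
    "para_J m = - m" "n \<bullet> m = 0"
proof
  \<comment> \<open>both eigencomponents of \<open>f\<close> have \<open>n\<close>-value 1/2; multiples of them correct those of \<open>z\<close>\<close>
  define a where "a = 2 * (n \<bullet> plus_part z)"
  define b where "b = 2 * (n \<bullet> minus_part z)"
  show "z = ((a + b)/2) *\<^sub>R f + ((a - b)/2) *\<^sub>R para_J f + (plus_part z - a *\<^sub>R plus_part f)
      + (minus_part z - b *\<^sub>R minus_part f)"
    using parts_sum[of z]
    by (simp add: vec_eq_iff forall_4 plus_part_def minus_part_def field_simps)
qed (use n_parts_f in \<open>simp_all add: para_J_diff para_J_scaleR inner_diff_right\<close>)

end

text \<open>\<open>w \<bullet> A J z = - J w \<bullet> A z\<close>, and \<open>J\<close> multiplies \<open>w\<close> and \<open>z\<close> by the same sign.\<close>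
lemma anticommute_imp_null:
  fixes A :: "real^4^4"
  assumes "A *v para_J z = - para_J (A *v z)"
    and "para_J w = w \<and> para_J z = z \<or> para_J w = - w \<and> para_J z = - z"
  shows "w \<bullet> (A *v z) = 0"
proof -
  have "w \<bullet> (A *v para_J z) = - (para_J w \<bullet> (A *v z))"
    by (simp add: assms(1) para_J_inner)
  then show ?thesis
    using assms(2) by (auto simp: linear_neg[OF matrix_vector_mul_linear])
qed

text \<open>The symmetric operator \<open>K = A J + J A\<close> kills \<open>f\<close> and \<open>J f\<close> by the two equations on \<open>A\<close>. It pairs
  eigenvectors of \<open>J\<close> with opposite eigenvalues to zero for free, and on eigenvectors with equal
  eigenvalue it is \<open>\<plusminus>2 A\<close>, so it vanishes there exactly when tangent eigenvectors are null for \<open>A\<close>.\<close>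
lemma anticommute_iff_null:
  fixes A :: "real^4^4"
  assumes "J_symmetric_point f n" and sym: "\<And>z w. z \<bullet> (A *v w) = w \<bullet> (A *v z)"
    and A_f: "A *v f = n" and A_Jf: "A *v para_J f = - para_J n"
  shows "(\<forall>z. A *v para_J z = - para_J (A *v z)) \<longleftrightarrow>
    (\<forall>z. n \<bullet> z = 0 \<and> (para_J z = z \<or> para_J z = - z) \<longrightarrow> z \<bullet> (A *v z) = 0)"
proof safe
  fix z assume anti: "\<forall>z. A *v para_J z = - para_J (A *v z)"
  show "z \<bullet> (A *v z) = 0" if "para_J z = z"
    by (rule anticommute_imp_null, rule anti[rule_format]) (simp add: that)
  show "z \<bullet> (A *v z) = 0" if "para_J z = - z"
    by (rule anticommute_imp_null, rule anti[rule_format]) (simp add: that)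
next
  interpret J_symmetric_point f n by fact
  assume null: "\<forall>z. n \<bullet> z = 0 \<and> (para_J z = z \<or> para_J z = - z) \<longrightarrow> z \<bullet> (A *v z) = 0"
  define K where "K z = A *v para_J z + para_J (A *v z)" for z
  note A_simps = matrix_vector_right_distrib matrix_vector_mult_scaleR linear_neg[OF matrix_vector_mul_linear]
  have K_add: "K (y + z) = K y + K z" and K_scale: "K (r *\<^sub>R z) = r *\<^sub>R K z" for y z r
    by (simp_all add: K_def para_J_add para_J_scaleR A_simps algebra_simps)
  have K_f: "K f = 0" "K (para_J f) = 0"
    by (simp_all add: K_def A_f A_Jf para_J_minus)
  have K_sym: "z \<bullet> K w = w \<bullet> K z" for z w
    by (simp add: K_def inner_right_distrib sym[of _ "para_J w"] sym[of _ "para_J z"] flip: para_J_inner)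
  have polar: "y \<bullet> (A *v z) = 0" if "n \<bullet> y = 0" "n \<bullet> z = 0"
    "para_J y = y \<and> para_J z = z \<or> para_J y = - y \<and> para_J z = - z" for y z
  proof -
    have "y \<bullet> (A *v y) = 0" "z \<bullet> (A *v z) = 0" "(y + z) \<bullet> (A *v (y + z)) = 0"
      using null[rule_format, of y] null[rule_format, of z] null[rule_format, of "y + z"] that
      by (auto simp: inner_right_distrib para_J_add)
    then show ?thesis
      using sym[of y z] by (simp add: A_simps inner_left_distrib inner_right_distrib)
  qed
  have K_eq: "y \<bullet> K z = y \<bullet> (A *v para_J z) + para_J y \<bullet> (A *v z)" for y z
    by (simp add: K_def inner_right_distrib para_J_inner)
  have eig: "y \<bullet> K z = 0" if "n \<bullet> y = 0" "n \<bullet> z = 0"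
    "para_J y = y \<or> para_J y = - y" "para_J z = z \<or> para_J z = - z" for y z
    using that polar[of y z] by (auto simp: K_eq A_simps)
  fix z
  have "y \<bullet> K z = 0" for y
  proof -
    obtain s t p m where z: "z = s *\<^sub>R f + t *\<^sub>R para_J f + p + m" "para_J p = p" "n \<bullet> p = 0"
      "para_J m = - m" "n \<bullet> m = 0" by (rule eigen_decomposition)
    obtain s' t' p' m' where y: "y = s' *\<^sub>R f + t' *\<^sub>R para_J f + p' + m'" "para_J p' = p'" "n \<bullet> p' = 0"
      "para_J m' = - m'" "n \<bullet> m' = 0" by (rule eigen_decomposition)
    have K0: "f \<bullet> K w = 0" "para_J f \<bullet> K w = 0" for w
      using K_sym[of f w] K_sym[of "para_J f" w] K_f by simp_all
    show ?thesis
      unfolding z(1) y(1)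
      by (simp add: K_add K_scale K_f K0 inner_right_distrib inner_left_distrib eig z y)
  qed
  then have "K z = 0" by (metis inner_eq_zero_iff)
  then show "A *v para_J z = - para_J (A *v z)"
    by (simp add: K_def eq_neg_iff_add_eq_0)
qed

text \<open>The condition says that \<open>J F\<close>, and hence \<open>J\<close> applied to the field \<open>-F\<close>, is tangent.\<close>
locale J_patch = centroaffine_patch +
  assumes N_JF: "u \<in> W \<Longrightarrow> N u \<bullet> para_J (F u) = 0"
begin

lemma J_point: "u \<in> W \<Longrightarrow> J_symmetric_point (F u) (N u)"
  by unfold_locales (simp_all add: N_F N_JF)

lemma diff_JF: "u \<in> W \<Longrightarrow> (\<lambda>x. para_J (F x)) differentiable (at u)"
  and dJF: "u \<in> W \<Longrightarrow> dir_deriv (\<lambda>x. para_J (F x)) u a = para_J (dir_deriv F u a)"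
  using bounded_linear.has_derivative[OF bounded_linear_para_J smooth_on_has_derivative[OF smooth_F], of u]
  by (auto simp: differentiable_def dir_deriv_eqI)

lemma dN_JF: "u \<in> W \<Longrightarrow> dir_deriv N u a \<bullet> para_J (F u) = - (N u \<bullet> para_J (dir_deriv F u a))"
  using inner_const_dir_deriv[OF open_W _ diff_N diff_JF N_JF, of u a] dJF by simp

end

locale J_osculating_patch = J_patch + osculating_patch
begin

text \<open>Pair with \<open>dF(a)\<close>: by symmetry \<open>dF(a) \<bullet> G J F = J F \<bullet> dN(a)\<close>, and the derivative of \<open>N \<bullet> J F = 0\<close>
  turns this into \<open>- N \<bullet> J dF(a)\<close>.\<close>
lemma G_JF:
  assumes u: "u \<in> W"
  shows "G u *v para_J (F u) = - para_J (N u)"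
proof (rule inner_eq_imp_eq)
  fix z
  obtain a where a: "z = (N u \<bullet> z) *\<^sub>R F u + dir_deriv F u a" by (rule decomposition[OF u])
  have "y \<bullet> (G u *v para_J (F u)) = y \<bullet> (- para_J (N u))"
    if y: "y = r *\<^sub>R F u + dir_deriv F u a" for y r
  proof -
    have "y \<bullet> (G u *v para_J (F u)) = para_J (F u) \<bullet> (G u *v y)"
      by (rule G_sym[OF u])
    also have "\<dots> = para_J (F u) \<bullet> (r *\<^sub>R N u + dir_deriv N u a)"
      by (simp add: y matrix_vector_right_distrib matrix_vector_mult_scaleR G_F[OF u] G_dF[OF u])
    also have "\<dots> = - (N u \<bullet> para_J (dir_deriv F u a))"
      using dN_JF[OF u, of a] N_JF[OF u]
      by (simp add: inner_right_distrib inner_commute[of "para_J (F u)"])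
    also have "\<dots> = - (N u \<bullet> para_J y)"
      using N_JF[OF u] by (simp add: y para_J_add para_J_scaleR inner_right_distrib)
    also have "\<dots> = y \<bullet> (- para_J (N u))"
      by (simp add: inner_commute[of "N u"] para_J_inner)
    finally show ?thesis .
  qed
  from this[OF a] show "z \<bullet> (G u *v para_J (F u)) = z \<bullet> (- para_J (N u))" .
qed

text \<open>The cubic form \<open>T\<close> is totally symmetric. It suffices to test it on \<open>J F\<close> and on tangent eigenvectors
  of \<open>J\<close>; it vanishes on \<open>J F\<close> since \<open>(D\<^sub>a G) J F = - J (D\<^sub>a G) F = 0\<close>, and three eigenvectors with
  eigenvalues \<open>\<plusminus>1\<close> contain two with the same eigenvalue.\<close>
lemma dG_eq_0:
  assumes anti: "\<And>x z. x \<in> W \<Longrightarrow> G x *v para_J z = - para_J (G x *v z)" and u: "u \<in> W"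
  shows "dir_deriv G u a = 0"
proof -
  interpret J_symmetric_point "F u" "N u" by (rule J_point[OF u])
  let ?G' = "dir_deriv G u"
  have dG_anti: "?G' a *v para_J z = - para_J (?G' a *v z)" for a z
  proof -
    have "linear (\<lambda>A :: real^4^4. A *v para_J z + para_J (A *v z))"
      by (rule linearI) (simp_all add: matrix_vector_mult_add_rdistrib scaleR_matrix_vector_assoc[symmetric]
          para_J_add para_J_scaleR algebra_simps)
    from dG_const[OF u this, of a] anti show ?thesis by (simp add: eq_neg_iff_add_eq_0)
  qed
  have dG_JF: "?G' a *v para_J (F u) = 0" for a
    using dG_anti[of a "F u"] dG_F[OF u, of a] by (simp add: para_J_0)
  define T where "T a b c = dir_deriv F u c \<bullet> (?G' a *v dir_deriv F u b)" for a b c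
  have T12: "T a b c = T b a c" for a b c
    using dG_dF[OF u, of a b] by (simp add: T_def)
  have T23: "T a b c = T a c b" for a b c
    using dG_sym[OF u] by (simp add: T_def)
  let ?P = "\<lambda>a. para_J (dir_deriv F u a) = dir_deriv F u a"
  let ?M = "\<lambda>a. para_J (dir_deriv F u a) = - dir_deriv F u a"
  have same: "T a b c = 0" if "?P b \<and> ?P c \<or> ?M b \<and> ?M c" for a b c
    unfolding T_def by (rule anticommute_imp_null, rule dG_anti) (use that in auto)
  \<comment> \<open>pigeonhole: total symmetry moves two arguments with equal eigenvalue to the last two places\<close>
  have pure: "T a b c = 0" if "?P a \<or> ?M a" "?P b \<or> ?M b" "?P c \<or> ?M c" for a b c
    using that same[of b c a] same[of a c b] same[of a b c] T12[of a b c] T23[of a b c] T23[of c a b]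
      T12[of a c b] by auto
  \<comment> \<open>reduces the last argument to an eigenvector\<close>
  have T_dec: "T a b c = 0" if "\<And>c. ?P c \<or> ?M c \<Longrightarrow> T a b c = 0" for a b c
  proof -
    obtain s t p m where z: "dir_deriv F u c = s *\<^sub>R F u + t *\<^sub>R para_J (F u) + p + m" "para_J p = p" "N u \<bullet> p = 0"
      "para_J m = - m" "N u \<bullet> m = 0" by (rule eigen_decomposition)
    obtain cp cm where c: "p = dir_deriv F u cp" "m = dir_deriv F u cm"
      using z(3,5) tangent_iff[OF u] by blast
    have "F u \<bullet> (?G' a *v w) = 0" "para_J (F u) \<bullet> (?G' a *v w) = 0" for w
      using dG_sym[OF u, of _ a w] dG_F[OF u] dG_JF by simp_all
    then have "T a b c = T a b cp + T a b cm"
      unfolding T_def z(1) c[symmetric] by (simp add: inner_left_distrib)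
    then show ?thesis
      using that[of cp] that[of cm] z(2,4) c by simp
  qed
  have "T a b c = 0" for a b c
  proof (rule T_dec)
    fix c assume c: "?P c \<or> ?M c"
    have "T a c b = 0"
    proof (rule T_dec)
      fix b assume b: "?P b \<or> ?M b"
      have "T c b a = 0"
        by (rule T_dec) (use pure b c in blast)
      then show "T a c b = 0"
        using T12[of a c b] T23[of c a b] by simp
    qed
    then show "T a b c = 0" using T23 by simp
  qed
  note T0 = this
  have "w \<bullet> (?G' a *v z) = 0" for w z
  proof -
    obtain b where b: "z = (N u \<bullet> z) *\<^sub>R F u + dir_deriv F u b" by (rule decomposition[OF u])
    obtain c where c: "w = (N u \<bullet> w) *\<^sub>R F u + dir_deriv F u c" by (rule decomposition[OF u])
    have 0: "F u \<bullet> (?G' a *v y) = 0" for y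
      using dG_sym[OF u, of _ a y] dG_F[OF u] by simp
    have "(r *\<^sub>R F u + dir_deriv F u c) \<bullet> (?G' a *v (s *\<^sub>R F u + dir_deriv F u b)) = 0" for r s
      using T0[of a b c]
      by (simp add: T_def matrix_vector_right_distrib matrix_vector_mult_scaleR dG_F[OF u] inner_left_distrib 0)
    then show ?thesis using b c by metis
  qed
  then have "?G' a *v z = 0" for z by (metis inner_eq_zero_iff)
  then show ?thesis by (metis matrix_eq matrix_vector_mult_0)
qed

end

section \<open>Hypersurfaces in quadrics\<close>

text \<open>Spanning vectors of the lines in which the kernel of \<open>n\<close> meets the eigenplanes
  \<open>{(a, b, a, b)}\<close> and \<open>{(a, b, -a, -b)}\<close> of \<open>J\<close>. They depend linearly on \<open>n\<close>, which makes the
  distributions \<open>\<D>\<^sup>\<plusminus>\<close> smooth.\<close>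
definition eps_plus :: "real^4 \<Rightarrow> real^4" where
  "eps_plus n = vector [n$2 + n$4, - (n$1 + n$3), n$2 + n$4, - (n$1 + n$3)]"

definition eps_minus :: "real^4 \<Rightarrow> real^4" where
  "eps_minus n = vector [n$2 - n$4, - (n$1 - n$3), - (n$2 - n$4), n$1 - n$3]"

lemma eps_props [simp]:
  "n \<bullet> eps_plus n = 0" "para_J (eps_plus n) = eps_plus n"
  "n \<bullet> eps_minus n = 0" "para_J (eps_minus n) = - eps_minus n"
  by (simp_all add: inner_4 eps_plus_def eps_minus_def vec_eq_iff forall_4 algebra_simps)

text \<open>If one of them vanished, \<open>n\<close> would be an eigenvector of \<open>J\<close>, and \<open>n \<bullet> J f = \<plusminus> n \<bullet> f\<close> would not be zero.\<close>
lemma (in J_symmetric_point) eps_nonzero: "eps_plus n \<noteq> 0" "eps_minus n \<noteq> 0"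
proof -
  have "para_J n = - n" if "eps_plus n = 0"
    using that by (simp add: eps_plus_def vec_eq_iff forall_4)
  then show "eps_plus n \<noteq> 0"
    using n_f n_Jf para_J_inner[of n f] by auto
  have "para_J n = n" if "eps_minus n = 0"
  proof -
    have "eps_minus n $ 1 = 0" "eps_minus n $ 4 = 0" using that by simp_all
    then have "n $ 2 = n $ 4" "n $ 1 = n $ 3" by (simp_all add: eps_minus_def)
    then show ?thesis by (simp add: vec_eq_iff forall_4)
  qed
  then show "eps_minus n \<noteq> 0"
    using n_f n_Jf para_J_inner[of n f] by auto
qed

lemma proportional_of_det_0:
  fixes a b c d :: real
  assumes "a * c + b * d = 0" "a \<noteq> 0 \<or> b \<noteq> 0"
  shows "\<exists>t. c = t * b \<and> d = - (t * a)"
proof (cases "b = 0")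
  case True
  then show ?thesis using assms by (intro exI[of _ "- d / a"]) auto
next
  case False
  then show ?thesis using assms by (intro exI[of _ "c / b"]) (auto simp: field_simps)
qed

lemma (in J_symmetric_point) eigenvector_eps:
  "n \<bullet> z = 0 \<and> para_J z = z \<longleftrightarrow> (\<exists>t. z = t *\<^sub>R eps_plus n)"
  "n \<bullet> z = 0 \<and> para_J z = - z \<longleftrightarrow> (\<exists>t. z = t *\<^sub>R eps_minus n)"
proof -
  have 1: "\<exists>t. z = t *\<^sub>R eps_plus n" if z: "n \<bullet> z = 0" "para_J z = z"
  proof -
    have e: "z $ 3 = z $ 1" "z $ 4 = z $ 2"
      using arg_cong[OF z(2), of "\<lambda>v. v $ 1"] arg_cong[OF z(2), of "\<lambda>v. v $ 2"] by simp_all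
    have "(n$1 + n$3) * z$1 + (n$2 + n$4) * z$2 = 0"
      using z(1) by (simp add: inner_4 e algebra_simps)
    moreover have "n$1 + n$3 \<noteq> 0 \<or> n$2 + n$4 \<noteq> 0"
    proof (rule ccontr)
      assume "\<not> ?thesis"
      then have "eps_plus n = 0" by (simp add: eps_plus_def vec_eq_iff forall_4)
      then show False using eps_nonzero(1) by simp
    qed
    ultimately obtain t where "z$1 = t * (n$2 + n$4)" "z$2 = - (t * (n$1 + n$3))"
      using proportional_of_det_0 by blast
    then show ?thesis
      by (intro exI[of _ t]) (simp add: vec_eq_iff forall_4 eps_plus_def e algebra_simps)
  qed
  have 2: "\<exists>t. z = t *\<^sub>R eps_minus n" if z: "n \<bullet> z = 0" "para_J z = - z"
  proof -
    have e: "z $ 3 = - z $ 1" "z $ 4 = - z $ 2"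
      using arg_cong[OF z(2), of "\<lambda>v. v $ 1"] arg_cong[OF z(2), of "\<lambda>v. v $ 2"] by simp_all
    have "(n$1 - n$3) * z$1 + (n$2 - n$4) * z$2 = 0"
      using z(1) by (simp add: inner_4 e algebra_simps)
    moreover have "n$1 - n$3 \<noteq> 0 \<or> n$2 - n$4 \<noteq> 0"
    proof (rule ccontr)
      assume "\<not> ?thesis"
      then have "n$1 - n$3 = 0" "n$2 - n$4 = 0" by blast+
      then have "eps_minus n = 0" unfolding eps_minus_def by (simp only: vec_eq_iff forall_4 vector_4 zero_index) simp
      then show False using eps_nonzero(2) by simp
    qed
    ultimately obtain t where "z$1 = t * (n$2 - n$4)" "z$2 = - (t * (n$1 - n$3))"
      using proportional_of_det_0 by blast
    then show ?thesis
      by (intro exI[of _ t]) (simp add: vec_eq_iff forall_4 eps_minus_def e algebra_simps)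
  qed
  show "n \<bullet> z = 0 \<and> para_J z = z \<longleftrightarrow> (\<exists>t. z = t *\<^sub>R eps_plus n)"
    using 1 by (auto simp: para_J_scaleR)
  show "n \<bullet> z = 0 \<and> para_J z = - z \<longleftrightarrow> (\<exists>t. z = t *\<^sub>R eps_minus n)"
    using 2 by (auto simp: para_J_scaleR)
qed

context J_patch
begin

text \<open>Half the gradient \<open>g = Q F + b\<close> is \<open>\<mu> N\<close>, and \<open>\<mu> \<noteq> 0\<close> because otherwise \<open>(F, 1)\<close> would lie in the kernel of
  the bordered matrix. The equation \<open>g \<bullet> J F = 0\<close> likewise has a gradient \<open>s = \<nu> N\<close>. Second derivatives
  give \<open>Q = \<mu> h\<close> and \<open>J Q + Q J = \<nu> h\<close> on tangent vectors. On eigenvectors of \<open>J\<close> the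
  operator \<open>J Q + Q J\<close> is \<open>2 Q\<close>, \<open>-2 Q\<close> or, for a mixed pair, \<open>0\<close>. Were \<open>\<nu> \<noteq> 0\<close>, then \<open>h\<close> would vanish on
  mixed pairs and, as \<open>2\<mu> = \<nu> = -2\<mu>\<close> is impossible, on one of the tangent eigenlines too; since both
  lines are orthogonal to \<open>J F\<close> for \<open>h\<close>, that line would lie in the kernel of \<open>h\<close>.\<close>
lemma quadric_null:
  fixes Q :: "real^4^4"
  assumes u: "u \<in> W"
    and nondeg: "\<And>a. (\<And>b. affine_metric u a b = 0) \<Longrightarrow> a = 0"
    and Q: "transpose Q = Q" "\<And>z s. Q *v z + s *\<^sub>R b = 0 \<Longrightarrow> b \<bullet> z + k * s = 0 \<Longrightarrow> z = 0 \<and> s = 0"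
    and quadric: "\<And>x. x \<in> W \<Longrightarrow> F x \<bullet> (Q *v F x) + 2 * (b \<bullet> F x) + k = 0"
    and eig: "para_J (dir_deriv F u a) = dir_deriv F u a \<or> para_J (dir_deriv F u a) = - dir_deriv F u a"
  shows "affine_metric u a a = 0"
proof -
  have Q_sym: "z \<bullet> (Q *v w) = w \<bullet> (Q *v z)" for z w
    using dot_lmul_matrix[of z Q w] vector_transpose_matrix[of z Q] Q(1) by (simp add: inner_commute)
  have bl_Q: "bounded_linear ((*v) Q)"
    using bounded_bilinear.bounded_linear_right[OF bounded_bilinear_matrix_vector] .
  define g where "g x = Q *v F x + b" for x
  have g_der: "(g has_derivative (\<lambda>a. Q *v dir_deriv F x a)) (at x)" if "x \<in> W" for x
    unfolding g_def
    using has_derivative_add[OF bounded_linear.has_derivative[OF bl_Q smooth_on_has_derivative[OF smooth_F that]]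
        has_derivative_const[of b]] by simp
  have g_tan: "g x \<bullet> dir_deriv F x a = 0" if x: "x \<in> W" for x a
  proof -
    have "g y \<bullet> F y + b \<bullet> F y = - k" if "y \<in> W" for y
      using quadric[OF that] by (simp add: g_def inner_left_distrib inner_commute algebra_simps)
    then have "(g y + b) \<bullet> F y = - k" if "y \<in> W" for y
      using that by (simp add: inner_left_distrib)
    moreover have "((\<lambda>x. g x + b) has_derivative (\<lambda>a. Q *v dir_deriv F x a)) (at x)"
      using has_derivative_add[OF g_der[OF x] has_derivative_const[of b]] by simp
    ultimately have "(Q *v dir_deriv F x a) \<bullet> F x = - (g x \<bullet> dir_deriv F x a) - b \<bullet> dir_deriv F x a"
      using inner_const_dir_deriv[OF open_W x _ diff_F[OF x], of "\<lambda>x. g x + b" "- k" a]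
      by (auto simp: dir_deriv_eqI differentiable_def inner_left_distrib)
    then show ?thesis
      using Q_sym[of "F x" "dir_deriv F x a"]
      by (simp add: g_def inner_left_distrib inner_right_distrib inner_commute)
  qed
  define \<mu> where "\<mu> x = g x \<bullet> F x" for x
  have conormal: "p = (p \<bullet> F x) *\<^sub>R N x" if x: "x \<in> W" and p: "\<And>a. p \<bullet> dir_deriv F x a = 0" for p x
  proof (rule inner_eq_imp_eq)
    fix z
    obtain a where a: "z = (N x \<bullet> z) *\<^sub>R F x + dir_deriv F x a" by (rule decomposition[OF x])
    have "(r *\<^sub>R F x + dir_deriv F x a) \<bullet> p = r * (p \<bullet> F x)" for r
      using p[of a] by (simp add: inner_right_distrib inner_commute[of _ p])
    from this[of "N x \<bullet> z"] show "z \<bullet> p = z \<bullet> ((p \<bullet> F x) *\<^sub>R N x)"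
      using a by (metis inner_commute inner_scaleR_right mult.commute)
  qed
  have g_N: "g x = \<mu> x *\<^sub>R N x" if "x \<in> W" for x
    unfolding \<mu>_def using conormal[OF that g_tan[OF that]] .
  have \<mu>_nz: "\<mu> u \<noteq> 0"
  proof
    assume 0: "\<mu> u = 0"
    then have "Q *v F u + 1 *\<^sub>R b = 0" using g_N[OF u] by (simp add: g_def)
    moreover have "b \<bullet> F u + k * 1 = - \<mu> u"
      using quadric[OF u] by (simp add: \<mu>_def g_def inner_left_distrib inner_commute algebra_simps)
    ultimately show False using Q(2)[of "F u" 1] 0 by simp
  qed
  define s where "s x = para_J (g x) + Q *v para_J (F x)" for x
  have JF: "(\<lambda>x. para_J (F x)) differentiable at x" if "x \<in> W" for x
    using diff_JF[OF that] .
  have s_tan: "s x \<bullet> dir_deriv F x a = 0" if x: "x \<in> W" for x a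
  proof -
    have "g y \<bullet> para_J (F y) = 0" if "y \<in> W" for y
      using g_N[OF that] N_JF[OF that] by simp
    from inner_const_dir_deriv[OF open_W x _ JF[OF x] this, of a]
    have "(Q *v dir_deriv F x a) \<bullet> para_J (F x) = - (g x \<bullet> para_J (dir_deriv F x a))"
      using g_der[OF x] by (auto simp: dir_deriv_eqI[OF g_der[OF x]] dJF[OF x] differentiable_def)
    then show ?thesis
      using Q_sym[of "para_J (F x)" "dir_deriv F x a"]
      by (simp add: s_def inner_left_distrib inner_right_distrib inner_commute para_J_inner)
  qed
  define \<nu> where "\<nu> = s u \<bullet> F u"
  have s_N: "s u = \<nu> *\<^sub>R N u"
    unfolding \<nu>_def using conormal[OF u s_tan[OF u]] .
  have bl_s: "(s has_derivative (\<lambda>a. para_J (Q *v dir_deriv F u a) + Q *v para_J (dir_deriv F u a))) (at u)"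
    unfolding s_def
    using has_derivative_add[OF bounded_linear.has_derivative[OF bounded_linear_para_J g_der[OF u]]
        bounded_linear.has_derivative[OF bl_Q
          bounded_linear.has_derivative[OF bounded_linear_para_J smooth_on_has_derivative[OF smooth_F u]]]] .
  \<comment> \<open>if \<open>p = r N\<close> at \<open>u\<close> and \<open>p\<close> stays conormal nearby, its derivative is \<open>r h\<close> on tangent vectors\<close>
  have second: "p' a \<bullet> dir_deriv F u c = r * affine_metric u a c"
    if p: "(p has_derivative p') (at u)" "p u = r *\<^sub>R N u" "\<And>x a. x \<in> W \<Longrightarrow> p x \<bullet> dir_deriv F x a = 0"
    for p p' r a c
  proof -
    have "p' a \<bullet> dir_deriv F u c = - (p u \<bullet> dir_deriv (\<lambda>x. dir_deriv F x c) u a)"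
      using inner_const_dir_deriv[OF open_W u _ diff_dF[OF u, of c] p(3), of a] p(1)
      by (auto simp: dir_deriv_eqI[OF p(1)] differentiable_def)
    then show ?thesis by (simp add: p(2) metric_eq[OF u])
  qed
  have QQ: "(Q *v dir_deriv F u a) \<bullet> dir_deriv F u c = \<mu> u * affine_metric u a c" for a c
    by (rule second[OF g_der[OF u] g_N[OF u] g_tan])
  have RR: "(para_J (Q *v dir_deriv F u a) + Q *v para_J (dir_deriv F u a)) \<bullet> dir_deriv F u c
      = \<nu> * affine_metric u a c" for a c
    by (rule second[OF bl_s s_N s_tan])
  let ?P = "\<lambda>a. para_J (dir_deriv F u a) = dir_deriv F u a"
  let ?M = "\<lambda>a. para_J (dir_deriv F u a) = - dir_deriv F u a"
  note Q_neg = linear_neg[OF matrix_vector_mul_linear, of Q]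
  have PP: "(2 * \<mu> u - \<nu>) * affine_metric u a c = 0" if "?P a" "?P c" for a c
    using RR[of a c] QQ[of a c] that by (simp add: inner_left_distrib para_J_inner algebra_simps)
  have MM: "(2 * \<mu> u + \<nu>) * affine_metric u a c = 0" if "?M a" "?M c" for a c
    using RR[of a c] QQ[of a c] that
    by (simp add: inner_left_distrib para_J_inner Q_neg algebra_simps)
  have PM: "\<nu> * affine_metric u a c = 0" if "?P a \<and> ?M c \<or> ?M a \<and> ?P c" for a c
    using RR[of a c] that by (auto simp: inner_left_distrib para_J_inner Q_neg)
  have "\<nu> = 0"
  proof (rule ccontr)
    assume \<nu>: "\<nu> \<noteq> 0"
    interpret J_symmetric_point "F u" "N u" by (rule J_point[OF u])
    have isotropic: False if e: "dir_deriv F u e \<noteq> 0" "?P e \<or> ?M e"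
      and h: "\<And>c. ?P c \<or> ?M c \<Longrightarrow> affine_metric u e c = 0" for e
    proof -
      have "affine_metric u e c = 0" for c
      proof -
        obtain r t p m where z: "dir_deriv F u c = r *\<^sub>R F u + t *\<^sub>R para_J (F u) + p + m" "para_J p = p" "N u \<bullet> p = 0"
          "para_J m = - m" "N u \<bullet> m = 0" by (rule eigen_decomposition)
        obtain cp cm where c: "p = dir_deriv F u cp" "m = dir_deriv F u cm"
          using z(3,5) tangent_iff[OF u] by blast
        have "dir_deriv N u e \<bullet> para_J (F u) = 0"
          using dN_JF[OF u, of e] e(2) N_tangent[OF u] by auto
        then show ?thesis
          unfolding z(1) using h[of cp] h[of cm] z c dN_F[OF u, of e] by (simp add: inner_right_distrib)
      qed
      then show False using nondeg[of e] e linear_0[OF linear_dF[OF u]] by blast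
    qed
    obtain ep em where e: "eps_plus (N u) = dir_deriv F u ep" "eps_minus (N u) = dir_deriv F u em"
      using tangent_iff[OF u] eps_props(1,3) by blast
    have ep: "?P ep" "dir_deriv F u ep \<noteq> 0" and em: "?M em" "dir_deriv F u em \<noteq> 0"
      using eps_nonzero eps_props(2,4)[of "N u"] e by simp_all
    show False
    proof (cases "2 * \<mu> u = \<nu>")
      case False
      have "affine_metric u ep c = 0" if "?P c \<or> ?M c" for c
        using that PP[OF ep(1), of c] PM[of ep c] ep(1) False \<nu> by fastforce
      then show False using isotropic[OF ep(2)] ep(1) by blast
    next
      case True
      then have "2 * \<mu> u + \<nu> \<noteq> 0" using \<mu>_nz by simp
      then have "affine_metric u em c = 0" if "?P c \<or> ?M c" for c
        using that MM[OF em(1), of c] PM[of em c] em(1) \<nu> by fastforce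
      then show False using isotropic[OF em(2)] em(1) by blast
    qed
  qed
  then show ?thesis
    using eig PP[of a a] MM[of a a] \<mu>_nz by auto
qed

end

section \<open>Tangent vectors in charts\<close>
locale smooth_3_manifold =
  fixes \<A> :: "('m::topological_space) chart set"
  assumes atlas: "smooth_atlas \<A>"
begin

lemma ex_chart: obtains c where "c \<in> charts_at \<A> x"
  using atlas unfolding smooth_atlas_def charts_at_def by blast

lemma charts_atD: "c \<in> charts_at \<A> x \<Longrightarrow> c \<in> \<A>" "c \<in> charts_at \<A> x \<Longrightarrow> x \<in> fst c"
  by (auto simp: charts_at_def)

lemma chart_homeomorphism:
  assumes "c \<in> \<A>"
  obtains g where "open (fst c)" "open (snd c ` fst c)" "homeomorphism (fst c) (snd c ` fst c) (snd c) g"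
  using assms atlas unfolding smooth_atlas_def is_chart_def by blast

lemma open_chart: "c \<in> \<A> \<Longrightarrow> open (fst c)" "c \<in> \<A> \<Longrightarrow> open (snd c ` fst c)"
  using chart_homeomorphism by blast+

lemma inj_chart: "c \<in> \<A> \<Longrightarrow> inj_on (snd c) (fst c)"
  by (rule chart_homeomorphism, assumption) (auto simp: homeomorphism_def intro: inj_on_inverseI)

lemma chart_inv_chart [simp]: "c \<in> \<A> \<Longrightarrow> x \<in> fst c \<Longrightarrow> chart_inv c (snd c x) = x"
  using inj_chart by (rule inv_into_f_f)

lemma open_chart_image:
  assumes "c \<in> \<A>" "open U"
  shows "open (snd c ` (U \<inter> fst c))"
proof -
  obtain g where g: "open (snd c ` fst c)" "homeomorphism (fst c) (snd c ` fst c) (snd c) g"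
    using chart_homeomorphism[OF assms(1)] .
  have "openin (top_of_set (fst c)) (U \<inter> fst c)"
    using assms(2) by (metis inf_commute openin_open_Int)
  from homeomorphism_imp_open_map[OF g(2) this] show ?thesis
    using g(1) openin_open_trans by blast
qed

lemma open_chart_preimage:
  assumes "c \<in> \<A>" "open V"
  shows "open (fst c \<inter> snd c -` V)"
proof (rule chart_homeomorphism[OF assms(1)])
  fix g assume "open (fst c)" "homeomorphism (fst c) (snd c ` fst c) (snd c) g"
  then show ?thesis
    using assms(2) by (auto simp: homeomorphism_def intro: continuous_open_preimage)
qed

lemma smooth_transition:
  assumes "c \<in> \<A>" "c' \<in> \<A>"
  shows "smooth_on (snd c ` (fst c \<inter> fst c')) (snd c' \<circ> chart_inv c)"
  using atlas assms unfolding smooth_atlas_def by blast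

lemma transition_has_derivative:
  assumes "c \<in> charts_at \<A> x" "c' \<in> charts_at \<A> x"
  shows "((snd c' \<circ> chart_inv c) has_derivative dir_deriv (snd c' \<circ> chart_inv c) (snd c x)) (at (snd c x))"
  using assms by (intro smooth_on_has_derivative[OF smooth_transition]) (auto simp: charts_at_def)

lemma dir_deriv_change_chart:
  fixes g :: "'m \<Rightarrow> 'b::real_normed_vector"
  assumes c: "c \<in> charts_at \<A> x" and c': "c' \<in> charts_at \<A> x"
    and g: "(g \<circ> chart_inv c') differentiable (at (snd c' x))"
  shows "dir_deriv (g \<circ> chart_inv c) (snd c x) a =
    dir_deriv (g \<circ> chart_inv c') (snd c' x) (dir_deriv (snd c' \<circ> chart_inv c) (snd c x) a)"
proof -
  note [simp] = charts_atD[OF c] charts_atD[OF c']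
  let ?S = "snd c ` (fst c' \<inter> fst c)"
  have "((g \<circ> chart_inv c') has_derivative dir_deriv (g \<circ> chart_inv c') (snd c' x))
      (at ((snd c' \<circ> chart_inv c) (snd c x)))"
    using g by (simp add: frechet_derivative_works)
  note comp = diff_chain_at[OF transition_has_derivative[OF c c'] this]
  have "dir_deriv (g \<circ> chart_inv c) (snd c x) = dir_deriv ((g \<circ> chart_inv c') \<circ> (snd c' \<circ> chart_inv c)) (snd c x)"
  proof (rule dir_deriv_cong)
    show "open ?S" by (rule open_chart_image) (simp_all add: open_chart)
  qed auto
  then show ?thesis
    by (simp add: dir_deriv_eqI[OF comp])
qed

lemma tangent_coord:
  assumes "v \<in> tangent_space \<A> x"
  shows "c \<in> charts_at \<A> x \<Longrightarrow> c' \<in> charts_at \<A> x \<Longrightarrow>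
      v c' = dir_deriv (snd c' \<circ> chart_inv c) (snd c x) (v c)"
    and "c \<notin> charts_at \<A> x \<Longrightarrow> v c = 0"
  using assms unfolding tangent_space_def by blast+

lemma tangentI:
  assumes "\<And>c c'. c \<in> charts_at \<A> x \<Longrightarrow> c' \<in> charts_at \<A> x \<Longrightarrow>
      v c' = dir_deriv (snd c' \<circ> chart_inv c) (snd c x) (v c)"
    and "\<And>c. c \<notin> charts_at \<A> x \<Longrightarrow> v c = 0"
  shows "v \<in> tangent_space \<A> x"
  using assms unfolding tangent_space_def by blast

text \<open>The derivative is defined through an unspecified chart; the chain rule and the transformation law of
  tangent vectors allow any other one.\<close>
lemma mderiv_chart:
  fixes g :: "'m \<Rightarrow> 'b::real_normed_vector"
  assumes c: "c \<in> charts_at \<A> x" and v: "v \<in> tangent_space \<A> x"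
    and g: "(g \<circ> chart_inv c) differentiable (at (snd c x))"
  shows "mderiv \<A> x g v = dir_deriv (g \<circ> chart_inv c) (snd c x) (v c)"
proof -
  define c0 where "c0 = (SOME c. c \<in> charts_at \<A> x)"
  have c0: "c0 \<in> charts_at \<A> x" unfolding c0_def using c by (rule someI)
  have "v c = dir_deriv (snd c \<circ> chart_inv c0) (snd c0 x) (v c0)"
    by (rule tangent_coord(1)[OF v c0 c])
  then show ?thesis
    using dir_deriv_change_chart[OF c0 c g] by (simp add: mderiv_def Let_def c0_def[symmetric])
qed

text \<open>The tangent vector at \<open>x\<close> with coordinate vector \<open>a\<close> in the chart \<open>c\<close>.\<close>
definition tangent_of :: "'m chart \<Rightarrow> 'm \<Rightarrow> real^3 \<Rightarrow> 'm tangent" where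
  "tangent_of c x a = (\<lambda>c'. if c' \<in> charts_at \<A> x then dir_deriv (snd c' \<circ> chart_inv c) (snd c x) a else 0)"

lemma tangent_of_in:
  assumes c: "c \<in> charts_at \<A> x"
  shows "tangent_of c x a \<in> tangent_space \<A> x"
proof -
  have "dir_deriv (snd c'' \<circ> chart_inv c) (snd c x) a
      = dir_deriv (snd c'' \<circ> chart_inv c') (snd c' x) (dir_deriv (snd c' \<circ> chart_inv c) (snd c x) a)"
    if "c' \<in> charts_at \<A> x" "c'' \<in> charts_at \<A> x" for c' c''
    using dir_deriv_change_chart[OF c that(1), of "snd c''"] transition_has_derivative[OF that]
    by (auto simp: differentiable_def)
  note eq = this
  show ?thesis
  proof (rule tangentI)
    fix c' c'' assume *: "c' \<in> charts_at \<A> x" "c'' \<in> charts_at \<A> x"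
    from eq[OF *] * show "tangent_of c x a c'' =
        dir_deriv (snd c'' \<circ> chart_inv c') (snd c' x) (tangent_of c x a c')"
      by (simp add: tangent_of_def)
  qed (simp add: tangent_of_def)
qed

lemma tangent_of_coord:
  assumes c: "c \<in> charts_at \<A> x"
  shows "tangent_of c x a c = a"
proof -
  have "dir_deriv (snd c \<circ> chart_inv c) (snd c x) = dir_deriv (\<lambda>u. u) (snd c x)"
    using charts_atD[OF c] by (intro dir_deriv_cong[of "snd c ` fst c"]) (auto simp: open_chart)
  then show ?thesis using c by (simp add: tangent_of_def)
qed

lemma tangent_scale:
  assumes "v \<in> tangent_space \<A> x"
  shows "(\<lambda>c. r *\<^sub>R v c) \<in> tangent_space \<A> x"
proof -
  have "dir_deriv (snd c' \<circ> chart_inv c) (snd c x) (r *\<^sub>R a) = r *\<^sub>R dir_deriv (snd c' \<circ> chart_inv c) (snd c x) a"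
    if "c \<in> charts_at \<A> x" "c' \<in> charts_at \<A> x" for c c' a
    using linear_cmul[OF has_derivative_linear[OF transition_has_derivative[OF that]]] .
  then show ?thesis
    using tangent_coord[OF assms] by (intro tangentI) (metis, simp)
qed

lemma zero_tangent: "(\<lambda>_. 0) \<in> tangent_space \<A> x"
proof -
  have "dir_deriv (snd c' \<circ> chart_inv c) (snd c x) 0 = 0"
    if "c \<in> charts_at \<A> x" "c' \<in> charts_at \<A> x" for c c'
    using linear_0[OF has_derivative_linear[OF transition_has_derivative[OF that]]] .
  then show ?thesis by (intro tangentI) simp_all
qed

lemma smooth_mapD:
  "smooth_map \<A> UNIV g \<Longrightarrow> c \<in> \<A> \<Longrightarrow> smooth_on (snd c ` fst c) (g \<circ> chart_inv c)"
  unfolding smooth_map_def by auto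

lemma smooth_map_differentiable:
  assumes "smooth_map \<A> UNIV g" "c \<in> charts_at \<A> x"
  shows "(g \<circ> chart_inv c) differentiable (at (snd c x))"
  using smooth_on_imp_differentiable[OF smooth_mapD] assms charts_atD[OF assms(2)] by blast

lemma mderiv_smooth:
  assumes "smooth_map \<A> UNIV g" "c \<in> charts_at \<A> x" "v \<in> tangent_space \<A> x"
  shows "mderiv \<A> x g v = dir_deriv (g \<circ> chart_inv c) (snd c x) (v c)"
  using mderiv_chart[OF assms(2,3) smooth_map_differentiable[OF assms(1,2)]] .

lemma mderiv_scale:
  assumes "smooth_map \<A> UNIV g" "v \<in> tangent_space \<A> x"
  shows "mderiv \<A> x g (\<lambda>c. r *\<^sub>R v c) = r *\<^sub>R mderiv \<A> x g v"
proof -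
  obtain c where c: "c \<in> charts_at \<A> x" by (rule ex_chart)
  have "linear (dir_deriv (g \<circ> chart_inv c) (snd c x))"
    using smooth_map_differentiable[OF assms(1) c] frechet_derivative_works has_derivative_linear by blast
  then show ?thesis
    using mderiv_smooth[OF assms(1) c] assms(2) tangent_scale[OF assms(2)] by (simp add: linear_cmul)
qed

end

section \<open>Conormal and second fundamental form\<close>
locale centroaffine_hypersurface = smooth_3_manifold \<A>
  for \<A> :: "('m::topological_space) chart set" +
  fixes f :: "'m \<Rightarrow> real^4"
  assumes imm: "immersion \<A> f" and centro: "centro_affine \<A> f"
begin

lemma smooth_f: "smooth_map \<A> UNIV f"
  using imm by (simp add: immersion_def)

lemma inj_f: "v \<in> tangent_space \<A> x \<Longrightarrow> w \<in> tangent_space \<A> x \<Longrightarrow> mderiv \<A> x f v = mderiv \<A> x f w \<Longrightarrow> v = w"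
  using imm unfolding immersion_def by (meson inj_onD)

lemmas mderiv_f = mderiv_smooth[OF smooth_f]

lemma tangent_image_chart:
  assumes c: "c \<in> charts_at \<A> x"
  shows "tangent_image \<A> f x = range (dir_deriv (f \<circ> chart_inv c) (snd c x))"
proof -
  have "dir_deriv (f \<circ> chart_inv c) (snd c x) a = mderiv \<A> x f (tangent_of c x a)" for a
    by (simp add: mderiv_f[OF c tangent_of_in[OF c]] tangent_of_coord[OF c])
  then show ?thesis
    using tangent_of_in[OF c] by (auto simp: tangent_image_def mderiv_f[OF c])
qed

definition conormal :: "'m \<Rightarrow> real^4" where
  "conormal x = (SOME n. n \<bullet> f x = 1 \<and> (\<forall>y\<in>tangent_image \<A> f x. n \<bullet> y = 0))"

text \<open>Split the position vector orthogonally along the tangent space; its normal part \<open>q\<close> is not zero, and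
  \<open>q / (q \<bullet> q)\<close> is the conormal.\<close>
lemma conormal: "conormal x \<bullet> f x = 1" "y \<in> tangent_image \<A> f x \<Longrightarrow> conormal x \<bullet> y = 0"
proof -
  obtain c where c: "c \<in> charts_at \<A> x" by (rule ex_chart)
  have "linear (dir_deriv (f \<circ> chart_inv c) (snd c x))"
    using smooth_map_differentiable[OF smooth_f c] frechet_derivative_works has_derivative_linear by blast
  then have sub: "subspace (tangent_image \<A> f x)"
    unfolding tangent_image_chart[OF c] by (rule linear_subspace_image) (rule subspace_UNIV)
  obtain p q where p: "p \<in> span (tangent_image \<A> f x)" "f x = p + q"
    and q: "\<And>w. w \<in> span (tangent_image \<A> f x) \<Longrightarrow> orthogonal q w"
    using orthogonal_subspace_decomp_exists[of "tangent_image \<A> f x" "f x"] by metis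
  have "q \<noteq> 0"
    using p centro sub by (auto simp: centro_affine_def span_eq_iff[THEN iffD2])
  have "(inverse (q \<bullet> q) *\<^sub>R q) \<bullet> f x = 1"
    using p q[OF p(1)] \<open>q \<noteq> 0\<close> by (simp add: inner_right_distrib orthogonal_def)
  moreover have "\<forall>y\<in>tangent_image \<A> f x. (inverse (q \<bullet> q) *\<^sub>R q) \<bullet> y = 0"
    using q by (auto simp: orthogonal_def span_base)
  ultimately have "conormal x \<bullet> f x = 1 \<and> (\<forall>y\<in>tangent_image \<A> f x. conormal x \<bullet> y = 0)"
    unfolding conormal_def
    by (intro someI[where P="\<lambda>n. n \<bullet> f x = 1 \<and> (\<forall>y\<in>tangent_image \<A> f x. n \<bullet> y = 0)"] conjI)
  then show "conormal x \<bullet> f x = 1" "y \<in> tangent_image \<A> f x \<Longrightarrow> conormal x \<bullet> y = 0" by auto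
qed

lemma patch:
  assumes c: "c \<in> \<A>"
  shows "centroaffine_patch (snd c ` fst c) (f \<circ> chart_inv c) (conormal \<circ> chart_inv c)"
proof
  show "open (snd c ` fst c)" by (rule open_chart[OF c])
  show "smooth_on (snd c ` fst c) (f \<circ> chart_inv c)" by (rule smooth_mapD[OF smooth_f c])
  fix u assume "u \<in> snd c ` fst c"
  then obtain x where x: "c \<in> charts_at \<A> x" "x \<in> fst c" "u = snd c x" using c by (auto simp: charts_at_def)
  show "a = 0" if "dir_deriv (f \<circ> chart_inv c) u a = 0" for a
  proof -
    have "mderiv \<A> x f (tangent_of c x a) = mderiv \<A> x f (tangent_of c x 0)"
      using that linear_0[OF has_derivative_linear[OF smooth_map_differentiable[OF smooth_f x(1),
              unfolded frechet_derivative_works]]]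
      by (simp add: mderiv_f[OF x(1)] tangent_of_in[OF x(1)] tangent_of_coord[OF x(1)] x(3))
    from inj_f[OF tangent_of_in[OF x(1)] tangent_of_in[OF x(1)] this] show ?thesis
      using tangent_of_coord[OF x(1)] by metis
  qed
  show "(conormal \<circ> chart_inv c) u \<bullet> (f \<circ> chart_inv c) u = 1"
    using conormal(1) by simp
  show "(conormal \<circ> chart_inv c) u \<bullet> dir_deriv (f \<circ> chart_inv c) u a = 0" for a
    using conormal(2)[of "dir_deriv (f \<circ> chart_inv c) u a" x] tangent_image_chart[OF x(1)] c x by auto
qed

lemma tangent_image_iff: "y \<in> tangent_image \<A> f x \<longleftrightarrow> conormal x \<bullet> y = 0"
proof -
  obtain c where c: "c \<in> charts_at \<A> x" by (rule ex_chart)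
  note D = charts_atD[OF c]
  interpret centroaffine_patch "snd c ` fst c" "f \<circ> chart_inv c" "conormal \<circ> chart_inv c"
    by (rule patch[OF D(1)])
  show ?thesis
    using tangent_iff[of "snd c x" y] D by (simp add: tangent_image_chart[OF c])
qed

lemma smooth_conormal: "smooth_map \<A> UNIV conormal"
  using centroaffine_patch.smooth_N[OF patch] by (simp add: smooth_map_def)

lemmas mderiv_conormal = mderiv_smooth[OF smooth_conormal]

text \<open>The second fundamental form for the field \<open>-f\<close>, expressed through the conormal.\<close>
definition h :: "'m \<Rightarrow> 'm tangent \<Rightarrow> 'm tangent \<Rightarrow> real" where
  "h x v w = mderiv \<A> x conormal v \<bullet> mderiv \<A> x f w"

lemma ex_tangent_field:
  assumes E: "smooth_map \<A> UNIV E" and tan: "\<And>y. conormal y \<bullet> E y = 0"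
  obtains Y where "smooth_vector_field \<A> UNIV Y" "\<And>y. mderiv \<A> y f (Y y) = E y"
proof -
  have "\<exists>Y. \<forall>y. Y y \<in> tangent_space \<A> y \<and> mderiv \<A> y f (Y y) = E y"
  proof (rule choice, rule allI)
    fix y
    have "E y \<in> tangent_image \<A> f y" by (simp add: tangent_image_iff tan)
    then show "\<exists>v. v \<in> tangent_space \<A> y \<and> mderiv \<A> y f v = E y"
      unfolding tangent_image_def by (elim imageE) auto
  qed
  then obtain Y where Y: "\<And>y. Y y \<in> tangent_space \<A> y" "\<And>y. mderiv \<A> y f (Y y) = E y" by blast
  have "smooth_vector_field \<A> UNIV Y"
    unfolding smooth_vector_field_def
  proof (intro conjI ballI)
    fix c assume c: "c \<in> \<A>"
    interpret centroaffine_patch "snd c ` fst c" "f \<circ> chart_inv c" "conormal \<circ> chart_inv c"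
      by (rule patch[OF c])
    have "smooth_on (snd c ` fst c) (\<lambda>u. Y (chart_inv c u) c)"
    proof (rule smooth_coordinates[OF smooth_mapD[OF E c] open_W subset_refl])
      fix u assume "u \<in> snd c ` fst c"
      then obtain x where x: "c \<in> charts_at \<A> x" "x \<in> fst c" "u = snd c x" using c by (auto simp: charts_at_def)
      show "dir_deriv (f \<circ> chart_inv c) u (Y (chart_inv c u) c) = (E \<circ> chart_inv c) u"
        using Y mderiv_f[OF x(1) Y(1)] c x by simp
    qed
    then show "smooth_on (snd c ` (UNIV \<inter> fst c)) (\<lambda>u. Y (chart_inv c u) c)" by simp
  qed (use Y in auto)
  with Y that show thesis by blast
qed

text \<open>This is the derivative of \<open>conormal \<bullet> f\<^sub>*Y = 0\<close>; it shows that only the value of \<open>Y\<close> at \<open>x\<close> matters.\<close>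
lemma conormal_deriv_field:
  assumes U: "open U" "x \<in> U" and Y: "smooth_vector_field \<A> U Y" and v: "v \<in> tangent_space \<A> x"
  shows "conormal x \<bullet> mderiv \<A> x (\<lambda>y. mderiv \<A> y f (Y y)) v = - h x v (Y x)"
proof -
  obtain c where c: "c \<in> charts_at \<A> x" by (rule ex_chart)
  note D = charts_atD[OF c]
  interpret centroaffine_patch "snd c ` fst c" "f \<circ> chart_inv c" "conormal \<circ> chart_inv c"
    by (rule patch[OF D(1)])
  let ?S = "snd c ` (U \<inter> fst c)"
  have S: "open ?S" by (rule open_chart_image[OF D(1) U(1)])
  have xS: "snd c x \<in> ?S" using D U by blast
  let ?g = "(\<lambda>y. mderiv \<A> y f (Y y)) \<circ> chart_inv c"
  have g: "?g u = dir_deriv (f \<circ> chart_inv c) u (Y (chart_inv c u) c)" if "u \<in> ?S" for u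
  proof -
    from that obtain y where y: "c \<in> charts_at \<A> y" "y \<in> fst c" "y \<in> U" "u = snd c y"
      using D by (auto simp: charts_at_def)
    have "Y y \<in> tangent_space \<A> y" using Y y by (auto simp: smooth_vector_field_def)
    from mderiv_f[OF y(1) this] show ?thesis using D y by simp
  qed
  have Yc: "smooth_on ?S (\<lambda>u. Y (chart_inv c u) c)"
    using Y D by (auto simp: smooth_vector_field_def)
  have "smooth_on ?S (\<lambda>u. \<Sum>i\<in>UNIV. Y (chart_inv c u) c $ i *\<^sub>R dir_deriv (f \<circ> chart_inv c) u (axis i 1))"
    by (intro smooth_on_sum smooth_on_scaleR S smooth_on_nth[OF S Yc]
        smooth_on_subset[OF smooth_on_dir_deriv[OF smooth_F]]) auto
  moreover have "?g u = (\<Sum>i\<in>UNIV. Y (chart_inv c u) c $ i *\<^sub>R dir_deriv (f \<circ> chart_inv c) u (axis i 1))"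
    if "u \<in> ?S" for u
    using g[OF that] dir_deriv_axis_sum[OF linear_dF] that by auto
  ultimately have "smooth_on ?S ?g"
    using iffD2[OF smooth_on_cong[OF S, of ?g "(\<lambda>u. \<Sum>i\<in>UNIV. Y (chart_inv c u) c $ i *\<^sub>R dir_deriv (f \<circ> chart_inv c) u (axis i 1))"]] by simp
  then have gd: "?g differentiable (at (snd c x))"
    using smooth_on_imp_differentiable xS by blast
  have "(conormal \<circ> chart_inv c) u \<bullet> ?g u = 0" if "u \<in> ?S" for u
    using N_tangent that g[OF that] by auto
  from inner_const_dir_deriv[OF S xS diff_N gd this, of "v c"]
  have "dir_deriv (conormal \<circ> chart_inv c) (snd c x) (v c) \<bullet> ?g (snd c x) =
    - (conormal x \<bullet> dir_deriv ?g (snd c x) (v c))"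
    using D by (simp add: o_def)
  then show ?thesis
    using mderiv_chart[OF c v gd] mderiv_conormal[OF c v] D by (simp add: h_def o_def)
qed

text \<open>Projecting the constant vector \<open>f\<^sub>*w\<close> along the position vector onto the tangent spaces gives even a
  global extension.\<close>
lemma ex_extension:
  assumes w: "w \<in> tangent_space \<A> x"
  obtains Y where "smooth_vector_field \<A> UNIV Y" "Y x = w"
proof -
  let ?a = "mderiv \<A> x f w"
  have a: "conormal x \<bullet> ?a = 0" using conormal(2) w by (auto simp: tangent_image_def)
  have "smooth_map \<A> UNIV (\<lambda>y. ?a - (conormal y \<bullet> ?a) *\<^sub>R f y)"
    unfolding smooth_map_def
  proof
    fix c assume c: "c \<in> \<A>"
    show "smooth_on (snd c ` (UNIV \<inter> fst c)) ((\<lambda>y. ?a - (conormal y \<bullet> ?a) *\<^sub>R f y) \<circ> chart_inv c)"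
      using smooth_mapD[OF smooth_f c] smooth_mapD[OF smooth_conormal c] open_chart[OF c]
      by (auto simp: o_def intro!: smooth_on_diff smooth_on_scaleR smooth_on_inner)
  qed
  moreover have "conormal y \<bullet> (?a - (conormal y \<bullet> ?a) *\<^sub>R f y) = 0" for y
    by (simp add: inner_diff_right conormal(1))
  ultimately obtain Y where Y: "smooth_vector_field \<A> UNIV Y"
    "\<And>y. mderiv \<A> y f (Y y) = ?a - (conormal y \<bullet> ?a) *\<^sub>R f y"
    by (rule ex_tangent_field) blast
  have "Y x = w"
    by (rule inj_f[OF _ w]) (use Y a in \<open>auto simp: smooth_vector_field_def\<close>)
  with Y that show thesis by blast
qed

lemma transversal_conormal: "transversal_field \<A> f C \<Longrightarrow> conormal x \<bullet> C x \<noteq> 0"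
  by (simp add: transversal_field_def tangent_image_iff)

text \<open>Apply the conormal to \<open>D\<^sub>v f\<^sub>*Y = f\<^sub>*z + r C\<close>: the tangential term disappears.\<close>
lemma second_fund_form_eq:
  assumes C: "transversal_field \<A> f C" and v: "v \<in> tangent_space \<A> x" and w: "w \<in> tangent_space \<A> x"
  shows "second_fund_form \<A> f C x v w = - (h x v w / (conormal x \<bullet> C x))"
  unfolding second_fund_form_def
proof (rule the_equality)
  let ?r = "- (h x v w / (conormal x \<bullet> C x))"
  obtain Y where Y: "smooth_vector_field \<A> UNIV Y" "Y x = w" by (rule ex_extension[OF w])
  let ?d = "mderiv \<A> x (\<lambda>y. mderiv \<A> y f (Y y)) v"
  have "conormal x \<bullet> (?d - ?r *\<^sub>R C x) = 0"
    using conormal_deriv_field[OF open_UNIV UNIV_I Y(1) v] transversal_conormal[OF C] Y(2)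
    by (simp add: inner_right_distrib)
  then have "?d - ?r *\<^sub>R C x \<in> tangent_image \<A> f x"
    by (simp only: tangent_image_iff)
  then obtain z where z: "?d - ?r *\<^sub>R C x = mderiv \<A> x f z" "z \<in> tangent_space \<A> x"
    unfolding tangent_image_def by (rule imageE)
  have "?d = mderiv \<A> x f z + ?r *\<^sub>R C x"
    using z(1) by (simp only: diff_eq_eq)
  with Y z(2) show "\<exists>U Y. open U \<and> x \<in> U \<and> smooth_vector_field \<A> U Y \<and> Y x = w \<and>
     (\<exists>z\<in>tangent_space \<A> x. mderiv \<A> x (\<lambda>y. mderiv \<A> y f (Y y)) v = mderiv \<A> x f z + ?r *\<^sub>R C x)"
    by (intro exI[of _ UNIV] exI[of _ Y]) auto
next
  fix r
  assume "\<exists>U Y. open U \<and> x \<in> U \<and> smooth_vector_field \<A> U Y \<and> Y x = w \<and>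
     (\<exists>z\<in>tangent_space \<A> x. mderiv \<A> x (\<lambda>y. mderiv \<A> y f (Y y)) v = mderiv \<A> x f z + r *\<^sub>R C x)"
  then obtain U Y z where Y: "open U" "x \<in> U" "smooth_vector_field \<A> U Y" "Y x = w"
    and z: "z \<in> tangent_space \<A> x" "mderiv \<A> x (\<lambda>y. mderiv \<A> y f (Y y)) v = mderiv \<A> x f z + r *\<^sub>R C x"
    by blast
  have "conormal x \<bullet> mderiv \<A> x f z = 0"
    using z conormal(2) by (auto simp: tangent_image_def)
  then have "r * (conormal x \<bullet> C x) = - h x v w"
    using conormal_deriv_field[OF Y(1-3) v] Y(4) by (simp add: z(2) inner_right_distrib)
  then show "r = - (h x v w / (conormal x \<bullet> C x))"
    using transversal_conormal[OF C, of x] by (simp add: field_simps)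
qed

end

section \<open>Constant osculating quadric: affine hyperspheres\<close>
lemma det_block_4:
  fixes M :: "real^4^4"
  assumes "M$4$1 = 0" "M$4$2 = 0" "M$4$3 = 0"
  shows "det M = M$4$4 * det (vector [vector [M$1$1, M$1$2, M$1$3], vector [M$2$1, M$2$2, M$2$3],
      vector [M$3$1, M$3$2, M$3$3]] :: real^3^3)"
proof -
  have f: "finite {2::4, 3, 4}" "1 \<notin> {2::4, 3, 4}" "finite {3::4, 4}" "2 \<notin> {3::4, 4}"
     "finite {4::4}" "3 \<notin> {4::4}"
    by auto
  show ?thesis
    unfolding det_3 vector_3
    unfolding det_def UNIV_4
    unfolding sum_over_permutations_insert[OF f(1,2)]
    unfolding sum_over_permutations_insert[OF f(3,4)]
    unfolding sum_over_permutations_insert[OF f(5,6)]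
    unfolding permutes_sing
    by (simp add: sign_swap_id permutation_swap_id sign_compose sign_id swap_id_eq assms algebra_simps)
qed

context centroaffine_hypersurface
begin

text \<open>The matrix of the osculating quadric at a point of the hypersurface.\<close>
definition osc :: "'m \<Rightarrow> real^4^4" where
  "osc x = (SOME A. A *v f x = conormal x \<and>
     (\<forall>v\<in>tangent_space \<A> x. A *v mderiv \<A> x f v = mderiv \<A> x conormal v))"

lemma osc: "osc x *v f x = conormal x"
  "v \<in> tangent_space \<A> x \<Longrightarrow> osc x *v mderiv \<A> x f v = mderiv \<A> x conormal v"
proof -
  obtain c where c: "c \<in> charts_at \<A> x" by (rule ex_chart)
  note D = charts_atD[OF c]
  interpret centroaffine_patch "snd c ` fst c" "f \<circ> chart_inv c" "conormal \<circ> chart_inv c"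
    by (rule patch[OF D(1)])
  have "snd c x \<in> snd c ` fst c" using D by blast
  from ex_osculating_matrix[OF this]
  have "\<exists>A. A *v f x = conormal x \<and>
      (\<forall>v\<in>tangent_space \<A> x. A *v mderiv \<A> x f v = mderiv \<A> x conormal v)"
    using D by (auto simp: mderiv_f[OF c] mderiv_conormal[OF c])
  from someI_ex[OF this]
  show "osc x *v f x = conormal x"
    "v \<in> tangent_space \<A> x \<Longrightarrow> osc x *v mderiv \<A> x f v = mderiv \<A> x conormal v"
    unfolding osc_def by auto
qed

lemma osc_patch:
  assumes c: "c \<in> \<A>"
  shows "osculating_patch (snd c ` fst c) (f \<circ> chart_inv c) (conormal \<circ> chart_inv c) (osc \<circ> chart_inv c)"
proof -
  interpret centroaffine_patch "snd c ` fst c" "f \<circ> chart_inv c" "conormal \<circ> chart_inv c"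
    by (rule patch[OF c])
  show ?thesis
  proof
    fix u assume "u \<in> snd c ` fst c"
    then obtain x where x: "c \<in> charts_at \<A> x" "x \<in> fst c" "u = snd c x" using c by (auto simp: charts_at_def)
    show "(osc \<circ> chart_inv c) u *v (f \<circ> chart_inv c) u = (conormal \<circ> chart_inv c) u"
      by (simp add: osc)
    show "(osc \<circ> chart_inv c) u *v dir_deriv (f \<circ> chart_inv c) u a = dir_deriv (conormal \<circ> chart_inv c) u a" for a
      using osc(2)[OF tangent_of_in[OF x(1)], of a] c x
      by (simp add: mderiv_f[OF x(1)] mderiv_conormal[OF x(1)] tangent_of_in[OF x(1)] tangent_of_coord[OF x(1)])
  qed
qed

lemma osc_sym: "z \<bullet> (osc x *v w) = w \<bullet> (osc x *v z)"
proof -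
  obtain c where c: "c \<in> charts_at \<A> x" by (rule ex_chart)
  note D = charts_atD[OF c]
  show ?thesis
    using osculating_patch.G_sym[OF osc_patch[OF D(1)], of "snd c x" z w] D by simp
qed

lemma h_osc: "v \<in> tangent_space \<A> x \<Longrightarrow> h x v w = mderiv \<A> x f w \<bullet> (osc x *v mderiv \<A> x f v)"
  by (simp add: h_def osc inner_commute)

lemma nondegenerate_h:
  assumes "nondegenerate \<A> f" "v \<in> tangent_space \<A> x" "\<And>w. w \<in> tangent_space \<A> x \<Longrightarrow> h x v w = 0"
  shows "v = (\<lambda>_. 0)"
  using assms unfolding nondegenerate_def by (auto simp: second_fund_form_eq)

lemma osc_kernel:
  assumes nondeg: "nondegenerate \<A> f" and z: "osc x *v z = 0"
  shows "z = 0"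
proof -
  have "conormal x \<bullet> z = 0"
    using osc_sym[of "f x" x z] z by (simp add: osc inner_commute)
  then obtain v where v: "z = mderiv \<A> x f v" "v \<in> tangent_space \<A> x"
    unfolding tangent_image_iff[symmetric] tangent_image_def by (rule imageE)
  have "v = (\<lambda>_. 0)"
    by (rule nondegenerate_h[OF nondeg v(2)]) (use z v in \<open>simp add: h_osc\<close>)
  then show ?thesis
    using mderiv_scale[OF smooth_f v(2), of 0] v(1) by simp
qed

lemma osc_transpose: "transpose (osc x) = osc x"
proof -
  have "osc x $ j $ i = osc x $ i $ j" for i j
    using osc_sym[of "axis i 1" x "axis j 1"]
    by (simp add: inner_axis' matrix_vector_mul_component inner_axis)
  then show ?thesis by (simp add: vec_eq_iff transpose_def)
qed

lemma null_direction_h: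
  assumes "null_direction \<A> f \<Delta>" "\<Delta> x \<subseteq> tangent_space \<A> x" "v \<in> \<Delta> x"
  shows "h x v v = 0"
proof -
  obtain C where "transversal_field \<A> f C" "second_fund_form \<A> f C x v v = 0"
    using assms(1,3) unfolding null_direction_def by blast
  then show ?thesis
    using second_fund_form_eq[of C v x v] transversal_conormal[of C x] assms(2,3) by auto
qed

lemma smooth_map_scale:
  assumes "smooth_map \<A> UNIV g"
  shows "smooth_map \<A> UNIV (\<lambda>x. r *\<^sub>R g x)"
  unfolding smooth_map_def
proof
  fix c assume c: "c \<in> \<A>"
  show "smooth_on (snd c ` (UNIV \<inter> fst c)) ((\<lambda>x. r *\<^sub>R g x) \<circ> chart_inv c)"
    using smooth_mapD[OF assms c] smooth_on_linear[OF open_chart(2)[OF c] bounded_linear_scaleR_right]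
    by (simp add: o_def)
qed

lemma transversal_f_scale: "r \<noteq> 0 \<Longrightarrow> transversal_field \<A> f (\<lambda>x. r *\<^sub>R f x)"
  unfolding transversal_field_def using smooth_map_scale[OF smooth_f]
  by (simp add: tangent_image_iff conormal)

lemma mderiv_f_scale:
  assumes v: "v \<in> tangent_space \<A> x"
  shows "mderiv \<A> x (\<lambda>x. r *\<^sub>R f x) v = r *\<^sub>R mderiv \<A> x f v"
proof -
  obtain c where c: "c \<in> charts_at \<A> x" by (rule ex_chart)
  have "((\<lambda>x. r *\<^sub>R f x) \<circ> chart_inv c has_derivative
      (\<lambda>a. r *\<^sub>R dir_deriv (f \<circ> chart_inv c) (snd c x) a)) (at (snd c x))"
    using has_derivative_scaleR_right[OF smooth_map_differentiable[OF smooth_f c, unfolded frechet_derivative_works], of r]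
    by (simp add: o_def)
  then show ?thesis
    by (simp add: mderiv_f[OF c v] mderiv_smooth[OF smooth_map_scale[OF smooth_f] c v] dir_deriv_eqI)
qed

text \<open>The derivative of \<open>- r f\<close> is \<open>- f\<^sub>*(r v)\<close>, without a transversal part.\<close>
lemma scaled_centro_affine:
  assumes r: "r \<noteq> 0" and v: "v \<in> tangent_space \<A> x"
  shows "transversal_form \<A> f (\<lambda>x. (- r) *\<^sub>R f x) x v = 0"
    and "shape_operator \<A> f (\<lambda>x. (- r) *\<^sub>R f x) x v = (\<lambda>c. r *\<^sub>R v c)"
proof -
  have t0: "t = 0" if "w \<in> tangent_space \<A> x"
    "mderiv \<A> x (\<lambda>x. (- r) *\<^sub>R f x) v = - mderiv \<A> x f w + t *\<^sub>R ((- r) *\<^sub>R f x)" for w t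
  proof -
    have "conormal x \<bullet> mderiv \<A> x f v = 0" "conormal x \<bullet> mderiv \<A> x f w = 0"
      using v that(1) by (auto simp: tangent_image_def intro!: conormal(2))
    moreover have "conormal x \<bullet> ((- r) *\<^sub>R mderiv \<A> x f v) =
        conormal x \<bullet> (- mderiv \<A> x f w + t *\<^sub>R ((- r) *\<^sub>R f x))"
      using that(2) by (simp only: mderiv_f_scale[OF v])
    ultimately show "t = 0"
      using r conormal(1)[of x] by (simp add: inner_diff_right)
  qed
  have ex: "mderiv \<A> x (\<lambda>x. (- r) *\<^sub>R f x) v = - mderiv \<A> x f (\<lambda>c. r *\<^sub>R v c) + 0 *\<^sub>R ((- r) *\<^sub>R f x)"
    by (simp only: mderiv_f_scale[OF v] mderiv_scale[OF smooth_f v]) simp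
  show "transversal_form \<A> f (\<lambda>x. (- r) *\<^sub>R f x) x v = 0"
    unfolding transversal_form_def
  proof (rule the_equality)
    show "\<exists>w\<in>tangent_space \<A> x. mderiv \<A> x (\<lambda>x. (- r) *\<^sub>R f x) v = - mderiv \<A> x f w + 0 *\<^sub>R ((- r) *\<^sub>R f x)"
      using ex tangent_scale[OF v] by blast
  qed (use t0 in blast)
  show "shape_operator \<A> f (\<lambda>x. (- r) *\<^sub>R f x) x v = (\<lambda>c. r *\<^sub>R v c)"
    unfolding shape_operator_def
  proof (rule the_equality)
    show "(\<lambda>c. r *\<^sub>R v c) \<in> tangent_space \<A> x \<and>
      (\<exists>t. mderiv \<A> x (\<lambda>x. (- r) *\<^sub>R f x) v = - mderiv \<A> x f (\<lambda>c. r *\<^sub>R v c) + t *\<^sub>R ((- r) *\<^sub>R f x))"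
      using ex tangent_scale[OF v] by blast
    fix w assume w: "w \<in> tangent_space \<A> x \<and>
      (\<exists>t. mderiv \<A> x (\<lambda>x. (- r) *\<^sub>R f x) v = - mderiv \<A> x f w + t *\<^sub>R ((- r) *\<^sub>R f x))"
    then obtain t where t: "mderiv \<A> x (\<lambda>x. (- r) *\<^sub>R f x) v = - mderiv \<A> x f w + t *\<^sub>R ((- r) *\<^sub>R f x)"
      by blast
    have "mderiv \<A> x f w = mderiv \<A> x f (\<lambda>c. r *\<^sub>R v c)"
      using t ex t0[OF _ t] w by simp
    then show "w = (\<lambda>c. r *\<^sub>R v c)"
      using inj_f w tangent_scale[OF v] by blast
  qed
qed

text \<open>With \<open>P\<close> the matrix of rows \<open>f\<^sub>*X\<^sub>i\<close> and \<open>- r f\<close>, the Gram matrix \<open>P G P\<^sup>T\<close> is block diagonal with blocks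
  \<open>h(X\<^sub>i, X\<^sub>j)\<close> and \<open>r\<^sup>2\<close>, and the second fundamental form of \<open>- r f\<close> is \<open>h / r\<close>. Taking determinants gives
  \<open>r\<^sup>2 \<cdot> r\<^sup>3\<close> on the left.\<close>
lemma volume_gram:
  assumes r: "r > 0" and X: "\<And>i. X i \<in> tangent_space \<A> x"
  shows "r ^ 5 * det ((\<chi> i j. second_fund_form \<A> f (\<lambda>x. (- r) *\<^sub>R f x) x (X i) (X j)) :: real^3^3)
    = (induced_volume \<A> f (\<lambda>x. (- r) *\<^sub>R f x) x X)\<^sup>2 * det (osc x)"
proof -
  let ?C = "\<lambda>x. (- r) *\<^sub>R f x"
  have C: "transversal_field \<A> f ?C" using transversal_f_scale[of "- r"] r by simp
  define P :: "real^4^4" where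
    "P = vector [mderiv \<A> x f (X 1), mderiv \<A> x f (X 2), mderiv \<A> x f (X 3), ?C x]"
  define M where "M = P ** osc x ** transpose P"
  have M: "M $ i $ j = P $ i \<bullet> (osc x *v P $ j)" for i j
  proof -
    have "M $ i $ j = (P *v (osc x *v P $ j)) $ i"
      unfolding M_def by (simp add: matrix_matrix_mult_def matrix_vector_mult_def transpose_def
          sum_distrib_left sum_distrib_right sum_4 algebra_simps)
    then show ?thesis by (simp add: matrix_vector_mul_component)
  qed
  have oC: "osc x *v ?C x = (- r) *\<^sub>R conormal x"
    by (simp only: matrix_vector_mult_scaleR osc)
  have tan: "mderiv \<A> x f (X i) \<bullet> conormal x = 0" for i
    using conormal(2)[of "mderiv \<A> x f (X i)" x] X by (auto simp: tangent_image_def inner_commute)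
  have sff: "second_fund_form \<A> f ?C x (X i) (X j) = h x (X i) (X j) / r" for i j
    using second_fund_form_eq[OF C X X] by (simp add: conormal)
  have hM: "mderiv \<A> x f (X i) \<bullet> (osc x *v mderiv \<A> x f (X j)) = h x (X i) (X j)" for i j
    using osc_sym h_osc[OF X] by metis
  have M4j: "M $ 4 $ j = (- r) * (P $ j \<bullet> conormal x)" for j
    using M[of 4 j] osc_sym[of "P $ 4" x "P $ j"] oC by (simp add: P_def)
  have M4: "M $ 4 $ 1 = 0" "M $ 4 $ 2 = 0" "M $ 4 $ 3 = 0" "M $ 4 $ 4 = r\<^sup>2"
    unfolding M4j by (simp_all add: P_def tan power2_eq_square inner_commute[of "f x"] conormal)
  have "det M = r\<^sup>2 * det ((\<chi> i j. h x (X i) (X j)) :: real^3^3)"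
    unfolding det_block_4[OF M4(1-3)] M4(4) by (simp add: det_3 M) (simp add: P_def hM)
  moreover have "det M = (det P)\<^sup>2 * det (osc x)"
    by (simp add: M_def det_mul power2_eq_square)
  moreover have "r ^ 3 * det ((\<chi> i j. h x (X i) (X j) / r) :: real^3^3) = det ((\<chi> i j. h x (X i) (X j)) :: real^3^3)"
    using r by (simp add: det_3 field_simps power3_eq_cube)
  ultimately have "r\<^sup>2 * (r ^ 3 * det ((\<chi> i j. h x (X i) (X j) / r) :: real^3^3)) = (det P)\<^sup>2 * det (osc x)"
    by simp
  then show ?thesis
    unfolding sff induced_volume_def P_def[symmetric]
    by (simp only: mult.assoc[symmetric] power_add[symmetric]) simp
qed

text \<open>By the Gram determinant the metric volume and the induced volume of \<open>- r f\<close> agree when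
  \<open>r\<^sup>5 = \<bar>det G\<bar>\<close>, and \<open>r\<close> can be chosen once for all points since \<open>G\<close> is constant.\<close>
lemma hypersphere_and_quadric:
  assumes nondeg: "nondegenerate \<A> f" and const: "\<And>x y. osc x = osc y"
  shows "affine_hypersphere \<A> f \<and> hyperquadric f"
proof
  obtain G where G: "\<And>x. osc x = G" using const by metis
  define r where "r = root 5 \<bar>det G\<bar>"
  have "det G \<noteq> 0"
    using osc_kernel[OF nondeg] unfolding G
    by (simp add: invertible_det_nz[symmetric] invertible_left_inverse matrix_left_invertible_ker)
  then have r: "r > 0" "r ^ 5 = \<bar>det G\<bar>"
    by (simp_all add: r_def)
  let ?C = "\<lambda>x. (- r) *\<^sub>R f x"
  have "metric_volume \<A> f ?C x X = induced_volume \<A> f ?C x X"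
    if "\<And>i. X i \<in> tangent_space \<A> x" "induced_volume \<A> f ?C x X > 0" for x X
  proof -
    have "\<bar>r ^ 5 * det ((\<chi> i j. second_fund_form \<A> f ?C x (X i) (X j)) :: real^3^3)\<bar>
      = (induced_volume \<A> f ?C x X)\<^sup>2 * r ^ 5"
      unfolding volume_gram[OF r(1) that(1)] G by (simp add: abs_mult r(2))
    then have "\<bar>det ((\<chi> i j. second_fund_form \<A> f ?C x (X i) (X j)) :: real^3^3)\<bar>
      = (induced_volume \<A> f ?C x X)\<^sup>2"
      using r(1) by (simp add: abs_mult)
    then show ?thesis
      using that(2) by (simp add: metric_volume_def)
  qed
  then have "blaschke_field \<A> f ?C"
    unfolding blaschke_field_def using transversal_f_scale[of "- r"] scaled_centro_affine r(1) by simp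
  then show "affine_hypersphere \<A> f"
    unfolding affine_hypersphere_def using scaled_centro_affine(2)[of r] r(1)
    by (intro exI[of _ ?C] exI[of _ r]) simp
  have "nondegenerate_quadric {z. z \<bullet> (G *v z) + 2 * (0 \<bullet> z) + (-1) = 0}"
    unfolding nondegenerate_quadric_def
  proof (intro exI conjI)
    show "transpose G = G" using osc_transpose unfolding G .
    show "G \<noteq> 0" using osc(1)[of undefined] conormal(1)[of undefined] unfolding G by auto
    show "\<forall>z s. G *v z + s *\<^sub>R 0 = 0 \<and> 0 \<bullet> z + - 1 * s = 0 \<longrightarrow> z = 0 \<and> s = 0"
      using osc_kernel[OF nondeg] unfolding G by simp
  qed (rule refl)
  moreover have "range f \<subseteq> {z. z \<bullet> (G *v z) + 2 * (0 \<bullet> z) + (-1) = 0}"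
    using osc(1) conormal(1) unfolding G by (auto simp: inner_commute)
  ultimately show "hyperquadric f"
    unfolding hyperquadric_def by blast
qed

end

section \<open>Null-directions\<close>
locale J_tangent_hypersurface = centroaffine_hypersurface +
  assumes J_tan: "J_tangent \<A> f (\<lambda>x. - f x)"
begin

lemma conormal_J: "conormal x \<bullet> para_J (f x) = 0"
  using J_tan by (simp add: J_tangent_def tangent_image_iff para_J_minus)

lemma symmetric_point: "J_symmetric_point (f x) (conormal x)"
  by unfold_locales (simp_all add: conormal conormal_J)

lemma J_patch_chart:
  "c \<in> \<A> \<Longrightarrow> J_patch (snd c ` fst c) (f \<circ> chart_inv c) (conormal \<circ> chart_inv c)"
  using patch by (simp add: J_patch_def J_patch_axioms_def conormal_J)

lemma J_osc_patch:
  "c \<in> \<A> \<Longrightarrow> J_osculating_patch (snd c ` fst c) (f \<circ> chart_inv c) (conormal \<circ> chart_inv c) (osc \<circ> chart_inv c)"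
  using osc_patch J_patch_chart by (simp add: J_osculating_patch_def)

text \<open>Eigenvectors of \<open>J\<close> in the tangent space lie in its image under \<open>J\<close> automatically.\<close>
lemma dist_D_iff:
  "v \<in> dist_D_plus \<A> f x \<longleftrightarrow> v \<in> tangent_space \<A> x \<and> para_J (mderiv \<A> x f v) = mderiv \<A> x f v"
  "v \<in> dist_D_minus \<A> f x \<longleftrightarrow> v \<in> tangent_space \<A> x \<and> para_J (mderiv \<A> x f v) = - mderiv \<A> x f v"
proof -
  have 1: "mderiv \<A> x f v \<in> tangent_image \<A> f x \<inter> para_J ` tangent_image \<A> f x"
    if "v \<in> tangent_space \<A> x" "para_J (mderiv \<A> x f v) = mderiv \<A> x f v \<or> para_J (mderiv \<A> x f v) = - mderiv \<A> x f v"
  proof -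
    have "mderiv \<A> x f v \<in> tangent_image \<A> f x" using that(1) by (simp add: tangent_image_def)
    moreover from this have "para_J (mderiv \<A> x f v) \<in> tangent_image \<A> f x"
      using that(2) by (auto simp: tangent_image_iff)
    then have "para_J (para_J (mderiv \<A> x f v)) \<in> para_J ` tangent_image \<A> f x"
      by (rule imageI)
    ultimately show ?thesis by simp
  qed
  show "v \<in> dist_D_plus \<A> f x \<longleftrightarrow> v \<in> tangent_space \<A> x \<and> para_J (mderiv \<A> x f v) = mderiv \<A> x f v"
    "v \<in> dist_D_minus \<A> f x \<longleftrightarrow> v \<in> tangent_space \<A> x \<and> para_J (mderiv \<A> x f v) = - mderiv \<A> x f v"
    using 1 unfolding dist_D_plus_def dist_D_minus_def dist_D_def by blast+
qed

lemma osc_JF: "osc x *v para_J (f x) = - para_J (conormal x)"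
proof -
  obtain c where c: "c \<in> charts_at \<A> x" by (rule ex_chart)
  note D = charts_atD[OF c]
  show ?thesis
    using J_osculating_patch.G_JF[OF J_osc_patch[OF D(1)], of "snd c x"] D by simp
qed

lemma osc_anticommute:
  assumes "\<And>v. v \<in> dist_D_plus \<A> f x \<Longrightarrow> h x v v = 0" "\<And>v. v \<in> dist_D_minus \<A> f x \<Longrightarrow> h x v v = 0"
  shows "osc x *v para_J z = - para_J (osc x *v z)"
proof -
  have "z \<bullet> (osc x *v z) = 0" if z: "conormal x \<bullet> z = 0" "para_J z = z \<or> para_J z = - z" for z
  proof -
    obtain v where v: "z = mderiv \<A> x f v" "v \<in> tangent_space \<A> x"
      using z(1) unfolding tangent_image_iff[symmetric] tangent_image_def by (rule imageE)
    then have "v \<in> dist_D_plus \<A> f x \<or> v \<in> dist_D_minus \<A> f x"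
      using z(2) by (simp add: dist_D_iff)
    then have "h x v v = 0" using assms by blast
    then show ?thesis using v by (simp add: h_osc)
  qed
  then show ?thesis
    using anticommute_iff_null[OF symmetric_point osc_sym osc(1) osc_JF] by blast
qed

lemma osc_locally_constant:
  assumes anti: "\<And>x z. osc x *v para_J z = - para_J (osc x *v z)"
  shows "\<exists>U. open U \<and> x \<in> U \<and> (\<forall>y\<in>U. osc x = osc y)"
proof -
  obtain c where c: "c \<in> charts_at \<A> x" by (rule ex_chart)
  note D = charts_atD[OF c]
  interpret J_osculating_patch "snd c ` fst c" "f \<circ> chart_inv c" "conormal \<circ> chart_inv c" "osc \<circ> chart_inv c"
    by (rule J_osc_patch[OF D(1)])
  obtain e where e: "e > 0" "ball (snd c x) e \<subseteq> snd c ` fst c"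
    using open_W D by (meson imageI openE)
  have "((osc \<circ> chart_inv c) has_derivative (\<lambda>a. 0)) (at u within ball (snd c x) e)"
    if "u \<in> ball (snd c x) e" for u
  proof (rule has_derivative_at_withinI)
    have u: "u \<in> snd c ` fst c" using that e by blast
    have "dir_deriv (osc \<circ> chart_inv c) u = (\<lambda>a. 0)"
      using dG_eq_0[OF _ u] anti by auto
    then show "((osc \<circ> chart_inv c) has_derivative (\<lambda>a. 0)) (at u)"
      using diff_G[OF u] by (simp add: frechet_derivative_works)
  qed
  note const = has_derivative_zero_unique[OF convex_ball this]
  have "osc x = osc y" if "y \<in> fst c \<inter> snd c -` ball (snd c x) e" for y
    using const[of "snd c x" "snd c y"] that e(1) D by simp
  moreover have "open (fst c \<inter> snd c -` ball (snd c x) e)"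
    by (rule open_chart_preimage[OF D(1) open_ball])
  ultimately show ?thesis
    using D e(1) by (intro exI[of _ "fst c \<inter> snd c -` ball (snd c x) e"]) auto
qed

lemma osc_constant:
  assumes "connected (UNIV :: 'a set)" and anti: "\<And>x z. osc x *v para_J z = - para_J (osc x *v z)"
  shows "osc x = osc y"
proof (rule connected_local_const[OF assms(1) UNIV_I UNIV_I])
  show "\<forall>a\<in>UNIV. eventually (\<lambda>b. osc a = osc b) (at a within UNIV)"
    using osc_locally_constant[OF anti] unfolding eventually_at_topological by (metis UNIV_I)
qed

lemma null_imp_hypersphere_and_quadric:
  assumes "connected (UNIV :: 'a set)" "nondegenerate \<A> f"
    and null: "null_direction \<A> f (dist_D_minus \<A> f)" "null_direction \<A> f (dist_D_plus \<A> f)"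
  shows "affine_hypersphere \<A> f \<and> hyperquadric f"
proof (rule hypersphere_and_quadric[OF assms(2) osc_constant[OF assms(1) osc_anticommute]])
  fix x v
  show "h x v v = 0" if "v \<in> dist_D_plus \<A> f x"
    by (rule null_direction_h[OF null(2) _ that]) (auto simp: dist_D_iff)
  show "h x v v = 0" if "v \<in> dist_D_minus \<A> f x"
    by (rule null_direction_h[OF null(1) _ that]) (auto simp: dist_D_iff)
qed

lemma quadric_imp_h_null:
  assumes nondeg: "nondegenerate \<A> f" and quadric: "hyperquadric f"
    and v: "v \<in> tangent_space \<A> x"
    and eig: "para_J (mderiv \<A> x f v) = mderiv \<A> x f v \<or> para_J (mderiv \<A> x f v) = - mderiv \<A> x f v"
  shows "h x v v = 0"
proof -
  obtain Q b k where Q: "transpose Q = Q"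
    "\<And>z s. Q *v z + s *\<^sub>R b = 0 \<Longrightarrow> b \<bullet> z + k * s = 0 \<Longrightarrow> z = 0 \<and> s = 0"
    "\<And>y. f y \<bullet> (Q *v f y) + 2 * (b \<bullet> f y) + k = 0"
    using quadric unfolding hyperquadric_def nondegenerate_quadric_def by blast
  obtain c where c: "c \<in> charts_at \<A> x" by (rule ex_chart)
  note D = charts_atD[OF c]
  interpret J_patch "snd c ` fst c" "f \<circ> chart_inv c" "conormal \<circ> chart_inv c"
    by (rule J_patch_chart[OF D(1)])
  have u: "snd c x \<in> snd c ` fst c" using D by blast
  have h_chart: "h x v w = affine_metric (snd c x) (v c) (w c)"
    if "v \<in> tangent_space \<A> x" "w \<in> tangent_space \<A> x" for v w
    using that by (simp add: h_def mderiv_f[OF c] mderiv_conormal[OF c])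
  have nd: "a = 0" if "\<And>b. affine_metric (snd c x) a b = 0" for a
  proof -
    have "tangent_of c x a = (\<lambda>_. 0)"
      by (rule nondegenerate_h[OF nondeg tangent_of_in[OF c]])
        (use that in \<open>simp add: h_chart tangent_of_in[OF c] tangent_of_coord[OF c]\<close>)
    then show ?thesis using tangent_of_coord[OF c, of a] by simp
  qed
  have "affine_metric (snd c x) (v c) (v c) = 0"
    by (rule quadric_null[OF u nd Q(1,2)]) (use Q(3) eig v in \<open>simp_all add: mderiv_f[OF c]\<close>)
  then show ?thesis by (simp add: h_chart v)
qed

lemma smooth_line_distributionI:
  assumes L: "linear L" and tan: "\<And>x. conormal x \<bullet> L (conormal x) = 0"
    and nz: "\<And>x. L (conormal x) \<noteq> 0"
    and \<Delta>: "\<And>x v. v \<in> \<Delta> x \<longleftrightarrow> v \<in> tangent_space \<A> x \<and> (\<exists>t. mderiv \<A> x f v = t *\<^sub>R L (conormal x))"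
  shows "smooth_line_distribution \<A> \<Delta>"
proof -
  have bl: "bounded_linear L" using L by (simp add: linear_conv_bounded_linear)
  have "smooth_map \<A> UNIV (\<lambda>x. L (conormal x))"
    unfolding smooth_map_def
    using smooth_mapD[OF smooth_conormal] smooth_on_linear[OF open_chart(2) bl] by (simp add: o_def)
  then obtain Y where Y: "smooth_vector_field \<A> UNIV Y" "\<And>y. mderiv \<A> y f (Y y) = L (conormal y)"
    by (rule ex_tangent_field[OF _ tan]) blast
  have YT: "Y y \<in> tangent_space \<A> y" for y
    using Y(1) by (simp add: smooth_vector_field_def)
  have "Y y \<noteq> (\<lambda>_. 0)" for y
    using mderiv_scale[OF smooth_f zero_tangent, of y 0] Y(2)[of y] nz[of y] by auto
  moreover have "\<Delta> y = {(\<lambda>c. t *\<^sub>R Y y c) | t. t \<in> UNIV}" for y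
  proof safe
    fix v assume "v \<in> \<Delta> y"
    then obtain t where v: "v \<in> tangent_space \<A> y" "mderiv \<A> y f v = t *\<^sub>R L (conormal y)"
      using \<Delta> by blast
    then have "v = (\<lambda>c. t *\<^sub>R Y y c)"
      using inj_f[OF v(1) tangent_scale[OF YT]] by (simp add: mderiv_scale[OF smooth_f YT] Y(2))
    then show "\<exists>t. v = (\<lambda>c. t *\<^sub>R Y y c) \<and> t \<in> UNIV" by blast
  next
    fix t
    show "(\<lambda>c. t *\<^sub>R Y y c) \<in> \<Delta> y"
      unfolding \<Delta> using tangent_scale[OF YT] mderiv_scale[OF smooth_f YT] Y(2) by auto
  qed
  ultimately show ?thesis
    unfolding smooth_line_distribution_def using Y(1) by (intro allI exI[of _ UNIV] exI[of _ Y]) auto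
qed

lemma null_directionI:
  assumes "smooth_line_distribution \<A> \<Delta>" "\<And>x. \<Delta> x \<subseteq> tangent_space \<A> x"
    and "\<And>x v. v \<in> \<Delta> x \<Longrightarrow> h x v v = 0"
  shows "null_direction \<A> f \<Delta>"
proof -
  have C: "transversal_field \<A> f (\<lambda>x. 1 *\<^sub>R f x)" by (rule transversal_f_scale) simp
  show ?thesis
    unfolding null_direction_def
    using assms second_fund_form_eq[OF C] C by (intro conjI exI[of _ "\<lambda>x. 1 *\<^sub>R f x"]) (auto simp: subset_iff)
qed

lemma linear_eps: "linear eps_plus" "linear eps_minus"
  by (rule linearI; simp add: eps_plus_def eps_minus_def vec_eq_iff forall_4 algebra_simps)+

lemma dist_D_smooth:
  "smooth_line_distribution \<A> (dist_D_plus \<A> f)" "smooth_line_distribution \<A> (dist_D_minus \<A> f)"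
proof -
  note eps = J_symmetric_point.eigenvector_eps[OF symmetric_point]
  have tan: "conormal x \<bullet> mderiv \<A> x f v = 0" if "v \<in> tangent_space \<A> x" for x v
    using that conormal(2) by (simp add: tangent_image_def)
  show "smooth_line_distribution \<A> (dist_D_plus \<A> f)"
  proof (rule smooth_line_distributionI[OF linear_eps(1)])
    show "v \<in> dist_D_plus \<A> f x \<longleftrightarrow>
        v \<in> tangent_space \<A> x \<and> (\<exists>t. mderiv \<A> x f v = t *\<^sub>R eps_plus (conormal x))" for x v
      unfolding dist_D_iff eps(1)[symmetric] using tan by blast
  qed (use J_symmetric_point.eps_nonzero[OF symmetric_point] in simp_all)
  show "smooth_line_distribution \<A> (dist_D_minus \<A> f)"
  proof (rule smooth_line_distributionI[OF linear_eps(2)])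
    show "v \<in> dist_D_minus \<A> f x \<longleftrightarrow>
        v \<in> tangent_space \<A> x \<and> (\<exists>t. mderiv \<A> x f v = t *\<^sub>R eps_minus (conormal x))" for x v
      unfolding dist_D_iff eps(2)[symmetric] using tan by blast
  qed (use J_symmetric_point.eps_nonzero[OF symmetric_point] in simp_all)
qed

lemma quadric_imp_null_directions:
  assumes "nondegenerate \<A> f" "hyperquadric f"
  shows "null_direction \<A> f (dist_D_minus \<A> f) \<and> null_direction \<A> f (dist_D_plus \<A> f)"
  using quadric_imp_h_null[OF assms]
  by (intro conjI null_directionI dist_D_smooth) (auto simp: dist_D_iff)

end

theorem theorem4p9:
  fixes \<A> :: "('m::{t2_space,second_countable_topology}) chart set"
    and f :: "'m \<Rightarrow> real^4"
  assumes "smooth_atlas \<A>"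
    and "connected (UNIV :: 'm set)"
    and "orientable \<A>"
    and "immersion \<A> f"
    and "nondegenerate \<A> f"
    and "centro_affine \<A> f"
    and "J_tangent \<A> f (\<lambda>x. - f x)"
  shows "(null_direction \<A> f (dist_D_minus \<A> f) \<and> null_direction \<A> f (dist_D_plus \<A> f)
            \<longrightarrow> affine_hypersphere \<A> f \<and> hyperquadric f) \<and>
         (hyperquadric f
            \<longrightarrow> null_direction \<A> f (dist_D_minus \<A> f) \<and> null_direction \<A> f (dist_D_plus \<A> f))"
proof -
  interpret J_tangent_hypersurface \<A> f
    using assms by unfold_locales
  show ?thesis
    using null_imp_hypersphere_and_quadric[OF assms(2,5)] quadric_imp_null_directions[OF assms(5)]
    by blast
qed

end
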